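(* Let $C(3,2/3)$ denote the smallest real number such that $|a_3|\leq C(3,2/3)\|f\|_{H^{2/3}}$ holds for every $f(z)=\sum_{n\geq0}a_nz^n$ in $H^{2/3}$; equivalently, \[C(3,2/3)=\sup\left\{\operatorname{Re}\frac{f'''(0)}{3!}\,:\,f\in H^{2/3},\ \|f\|_{H^{2/3}}=1\right\}.\] Then \[C(3,2/3)=\sqrt{\frac{2\left(1103+33\sqrt{33}\,\right)}{1153}}=1.4973\ldots\] Moreover, up to the rotations $f(z)\mapsto e^{-3i\theta}f(e^{i\theta}z)$ with $\theta\in\mathbb{R}$, the extremal function (the function $f$ in $H^{2/3}$ with $\|f\|_{H^{2/3}}=1$ attaining the supremum above) is \[f(z)=\left(\frac{483-19\sqrt{33}}{1153}\right)^{\frac{3}{2}}\left(1+\frac{\sqrt{3+\frac{1}{3}\sqrt{33}}}{2}\,z+\frac{1+\sqrt{33}}{8}\,z^2+\frac{\sqrt{15-\sqrt{33}}}{8}\,z^3\right)^3.\] That is, this $f$ attains the supremum, and the functions attaining the supremum are exactly the functions $z\mapsto e^{-3i\theta}f(e^{i\theta}z)$, $\theta\in\mathbb{R}$.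
   Context: For $0<p<\infty$, the Hardy space $H^p$ consists of the analytic functions $f$ in the unit disc $\mathbb{D}=\{z\in\mathbb{C}:|z|<1\}$ such that $\|f\|_{H^p}^p=\lim_{r\to1^-}\int_0^{2\pi}|f(re^{i\theta})|^p\,\frac{d\theta}{2\pi}<\infty$. For $0<p<1$ (here $p=2/3$) the quantity $\|\cdot\|_{H^p}$ is only a quasi-norm. *)

theory Defs
  imports "HOL-Complex_Analysis.Complex_Analysis"
begin

definition hardy_mean :: "real \<Rightarrow> (complex \<Rightarrow> complex) \<Rightarrow> real \<Rightarrow> real" where
  "hardy_mean p f r = integral {0..2*pi} (\<lambda>\<theta>. cmod (f (rcis r \<theta>)) powr p / (2*pi))"

text \<open>
  Elements are functions on the whole plane; only their values on the open unit disc matter,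
  so equality of elements means agreement on \<open>ball 0 1\<close>.
\<close>

definition hardy_space :: "real \<Rightarrow> (complex \<Rightarrow> complex) set" where
  "hardy_space p = {f. f holomorphic_on ball 0 1 \<and> (\<exists>L. (hardy_mean p f \<longlongrightarrow> L) (at_left 1))}"

definition hardy_norm :: "real \<Rightarrow> (complex \<Rightarrow> complex) \<Rightarrow> real" where
  "hardy_norm p f = Lim (at_left 1) (hardy_mean p f) powr (1 / p)"

definition coeff_bound :: "nat \<Rightarrow> real \<Rightarrow> real \<Rightarrow> bool" where
  "coeff_bound k p C \<longleftrightarrow>
     (\<forall>f\<in>hardy_space p. \<forall>a :: nat \<Rightarrow> complex.
        (\<forall>z\<in>ball 0 1. (\<lambda>n. a n * z ^ n) sums f z) \<longrightarrow> cmod (a k) \<le> C * hardy_norm p f)"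

text \<open>
  As \<open>LEAST\<close> over the reals is unspecified when no minimum exists, existence of the minimum has
  to be asserted separately wherever this constant is used.
\<close>

definition coeff_const :: "nat \<Rightarrow> real \<Rightarrow> real" where
  "coeff_const k p = (LEAST C. coeff_bound k p C)"

definition extremal_fun :: "complex \<Rightarrow> complex" where
  "extremal_fun z =
     of_real (((483 - 19 * sqrt 33) / 1153) powr (3/2)) *
     (1 + of_real (sqrt (3 + 1/3 * sqrt 33) / 2) * z
        + of_real ((1 + sqrt 33) / 8) * z ^ 2
        + of_real (sqrt (15 - sqrt 33) / 8) * z ^ 3) ^ 3"

end

theory Submission
  imports Defs "HOL-Real_Asymp.Real_Asymp"
begin

text \<open>
  Let \<open>M\<close> be the asserted constant. A function \<open>f\<close> in \<open>H\<^sup>p\<close>, \<open>p = 2/3\<close>, factors as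
  \<open>f = B g\<^sup>3\<close> with an inner function \<open>B\<close> and \<open>g\<close> in \<open>H\<^sup>2\<close> satisfying
  \<open>\<parallel>g\<parallel>\<^sup>2 = \<parallel>f\<parallel>\<^sup>p\<close>. Writing this as \<open>f = u v v\<close> with \<open>u = B g\<close> and \<open>v = g\<close> of the same \<open>H\<^sup>2\<close> norm,
  the coefficient \<open>a\<^sub>3\<close> of \<open>f\<close> becomes a trilinear form that sees only the first four Taylor
  coefficients of \<open>u\<close> and \<open>v\<close>. The nonlinear extremal problem is thereby reduced to a norm estimate
  for a form on a four-dimensional Hilbert space.

  By Cauchy--Schwarz in \<open>u\<close> that estimate is a quartic inequality in the moduli of the first four
  coefficients of \<open>v\<close>, and \<open>quartic_sos\<close> certifies it by an explicit sum of squares over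
  \<open>\<rat>(\<surd>33)\<close>. Every square is of the form \<open>(y - r x)\<^sup>2\<close> with monomials \<open>x\<close>, \<open>y\<close>, so the certificate
  also determines the equality case: the moduli have to be those of the extremal cubic polynomial,
  and as all terms of the trilinear form must then have the same argument, the phases are those of a
  rotation (\<open>cubic_coeff_bound\<close>, \<open>cubic_coeff_equality\<close>).

  To avoid boundary values, the factorization is carried out for the dilations \<open>f(r z)\<close> with radii
  \<open>r < 1\<close> such that \<open>f\<close> has no zero of modulus \<open>r\<close>. These are holomorphic beyond the closed disc, so
  a finite Blaschke product suffices, and Bessel's inequality on the unit circle replaces the theory
  of \<open>H\<^sup>2\<close> (\<open>hardy_factorization\<close>). Letting \<open>r\<close> tend to \<open>1\<close> gives \<open>third_coefficient_bound\<close>. For an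
  extremal \<open>f\<close>, the first four coefficients of the factors converge along a subsequence to a pair
  attaining equality in the finite-dimensional problem. That pair already exhausts the norm, so
  by Bessel's inequality all other coefficients of the factors tend to \<open>0\<close>, and every coefficient of
  \<open>f\<close> is that of a rotated extremal function (\<open>extremal_unique\<close>).
\<close>

section \<open>A quartic inequality by sums of squares\<close>

lemma weighted_square:
  fixes w r k t x y :: real
  assumes "w * r = k" "k * r = t"
  shows "w * (y - r * x)^2 = w * y^2 - 2 * k * (x * y) + t * x^2"
  unfolding assms(1)[symmetric] assms(2)[symmetric]
  by (simp add: power2_eq_square algebra_simps)

text \<open>
  The identity below after its squares have been expanded; \<open>A\<close>, \<open>B\<close>, \<open>C\<close>, \<open>D\<close> stand for the squares
  of the four variables, \<open>z\<close> for \<open>a b c d\<close> and \<open>y\<close> for \<open>a b\<^sup>2 c\<close>. All coefficients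
  have the reduced form \<open>p + q s\<close> with rational \<open>p\<close>, \<open>q\<close>, so that only linear bookkeeping remains.
\<close>

lemma quartic_sos_reduced:
  fixes s A B C D z y :: real
  shows "2 * (1103 + 33 * s) / 1153 * (A + B + C + D)^2
     - (4 * (A*D + 2*z + B*C) + (4*(A*C) + 4*y + B^2) + 4 * (A*B) + A^2) =
     ((7309 - 235 * s) / 9224 * B^2 - 2 * ((29013 + 2597 * s) / 55344) * (A*B) + (57803 + 8731 * s) / 110688 * A^2)
   + ((183743 - 22735 * s) / 110688 * C^2 - 2 * ((9271 - 792 * s) / 13836) * (A*C) + (131471 - 4193 * s) / 442752 * A^2)
   + ((14108 - 364 * s) / 10377 * D^2 - 2 * ((13977 - 1223 * s) / 41508) * (A*D) + (41669 - 5387 * s) / 442752 * A^2)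
   + ((55685 + 24011 * s) / 110688 * C^2 - 2 * ((1341 + 9515 * s) / 55344) * (B*C) + (5891 * s - 12245) / 36896 * B^2)
   + ((7274 + 134 * s) / 10377 * D^2 - 2 * ((1453 - 198 * s) / 3459) * (B*D) + (16705 - 2839 * s) / 36896 * B^2)
   + ((824 * s - 1528) / 10377 * D^2 - 2 * ((559 * s - 2559) / 10377) * (C*D) + (1265 * s - 6913) / 27672 * C^2)
   + 7/6 * (A*C - 4*z + 4*(B*D))
   + ((s - 1)/2 * (B*C) - 2*2 * y + (1 + s)/4 * (A*B))
   + ((30 + 2 * s)/9 * (C*D) - 2*(4/3) * z + (15 - s)/24 * (A*B))
   + ((9 + s)/18 * (A*D) - 2*(1/3) * z + (9 - s)/24 * (B*C))"
  apply (simp only: power2_eq_square add_divide_distrib diff_divide_distrib ring_distribs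
      times_divide_eq_left times_divide_eq_right)
  apply (simp add: mult_ac)
  done

text \<open>
  For \<open>s = \<surd>33\<close> the quartic form on the left vanishes at the positive vector \<open>(a, b, c, d)\<close> whose squares
  are proportional to \<open>1\<close>, \<open>(9 + s)/12\<close>, \<open>(17 + s)/32\<close>, \<open>(15 - s)/64\<close>, and every square on the right
  vanishes there as well.
  The Gram matrix of the form in the monomials of degree two is chosen with nonpositive off-diagonal
  entries; as it annihilates a positive vector, it behaves like a weighted graph Laplacian and splits
  into squares of binomials. The free parameters left by this choice are set to \<open>-2\<close> (coupling of
  \<open>a b\<close> and \<open>b c\<close>), \<open>-4/3\<close> (\<open>a b\<close> and \<open>c d\<close>) and \<open>-1/3\<close> (\<open>a d\<close> and \<open>b c\<close>), which keeps all
  weights positive.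
\<close>

lemma quartic_sos:
  fixes a b c d s :: real
  assumes ss: "s * s = 33"
  shows "2 * (1103 + 33 * s) / 1153 * (a^2 + b^2 + c^2 + d^2)^2
     - (4 * (a*d + b*c)^2 + (2*a*c + b^2)^2 + 4 * (a*b)^2 + (a^2)^2) =
     (7309 - 235 * s) / 9224 * (b^2 - (9 + s)/12 * a^2)^2
   + (183743 - 22735 * s) / 110688 * (c^2 - (17 + s)/32 * a^2)^2
   + (14108 - 364 * s) / 10377 * (d^2 - (15 - s)/64 * a^2)^2
   + (55685 + 24011 * s) / 110688 * (c^2 - (15 - s)/16 * b^2)^2
   + (7274 + 134 * s) / 10377 * (d^2 - (21 - 3 * s)/32 * b^2)^2
   + (824 * s - 1528) / 10377 * (d^2 - (9 - s)/16 * c^2)^2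
   + 7/6 * (a*c - 2*b*d)^2
   + (s - 1)/2 * (b*c - (1 + s)/8 * (a*b))^2
   + (30 + 2 * s)/9 * (c*d - (15 - s)/32 * (a*b))^2
   + (9 + s)/18 * (a*d - (9 - s)/8 * (b*c))^2"
proof -
  \<comment> \<open>Only here is \<open>s\<^sup>2 = 33\<close> used: it reduces the coefficients of each expanded square to the
    form \<open>p + q s\<close> with rational \<open>p\<close> and \<open>q\<close>.\<close>
  have 1: "(7309 - 235 * s) / 9224 * (b^2 - (9 + s) / 12 * (a^2))^2
      = (7309 - 235 * s) / 9224 * (b^2)^2 - 2 * ((29013 + 2597 * s) / 55344) * ((a^2) * (b^2)) + (57803 + 8731 * s) / 110688 * (a^2)^2"
  proof (rule weighted_square)
    show "(7309 - 235 * s) / 9224 * ((9 + s) / 12) = (29013 + 2597 * s) / 55344" using ss by (simp add: field_simps)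
    show "(29013 + 2597 * s) / 55344 * ((9 + s) / 12) = (57803 + 8731 * s) / 110688" using ss by (simp add: field_simps)
  qed
  have 2: "(183743 - 22735 * s) / 110688 * (c^2 - (17 + s) / 32 * (a^2))^2
      = (183743 - 22735 * s) / 110688 * (c^2)^2 - 2 * ((9271 - 792 * s) / 13836) * ((a^2) * (c^2)) + (131471 - 4193 * s) / 442752 * (a^2)^2"
  proof (rule weighted_square)
    show "(183743 - 22735 * s) / 110688 * ((17 + s) / 32) = (9271 - 792 * s) / 13836" using ss by (simp add: field_simps)
    show "(9271 - 792 * s) / 13836 * ((17 + s) / 32) = (131471 - 4193 * s) / 442752" using ss by (simp add: field_simps)
  qed
  have 3: "(14108 - 364 * s) / 10377 * (d^2 - (15 - s) / 64 * (a^2))^2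
      = (14108 - 364 * s) / 10377 * (d^2)^2 - 2 * ((13977 - 1223 * s) / 41508) * ((a^2) * (d^2)) + (41669 - 5387 * s) / 442752 * (a^2)^2"
  proof (rule weighted_square)
    show "(14108 - 364 * s) / 10377 * ((15 - s) / 64) = (13977 - 1223 * s) / 41508" using ss by (simp add: field_simps)
    show "(13977 - 1223 * s) / 41508 * ((15 - s) / 64) = (41669 - 5387 * s) / 442752" using ss by (simp add: field_simps)
  qed
  have 4: "(55685 + 24011 * s) / 110688 * (c^2 - (15 - s) / 16 * (b^2))^2
      = (55685 + 24011 * s) / 110688 * (c^2)^2 - 2 * ((1341 + 9515 * s) / 55344) * ((b^2) * (c^2)) + (5891 * s - 12245) / 36896 * (b^2)^2"
  proof (rule weighted_square)
    show "(55685 + 24011 * s) / 110688 * ((15 - s) / 16) = (1341 + 9515 * s) / 55344" using ss by (simp add: field_simps)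
    show "(1341 + 9515 * s) / 55344 * ((15 - s) / 16) = (5891 * s - 12245) / 36896" using ss by (simp add: field_simps)
  qed
  have 5: "(7274 + 134 * s) / 10377 * (d^2 - (21 - 3 * s) / 32 * (b^2))^2
      = (7274 + 134 * s) / 10377 * (d^2)^2 - 2 * ((1453 - 198 * s) / 3459) * ((b^2) * (d^2)) + (16705 - 2839 * s) / 36896 * (b^2)^2"
  proof (rule weighted_square)
    show "(7274 + 134 * s) / 10377 * ((21 - 3 * s) / 32) = (1453 - 198 * s) / 3459" using ss by (simp add: field_simps)
    show "(1453 - 198 * s) / 3459 * ((21 - 3 * s) / 32) = (16705 - 2839 * s) / 36896" using ss by (simp add: field_simps)
  qed
  have 6: "(824 * s - 1528) / 10377 * (d^2 - (9 - s) / 16 * (c^2))^2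
      = (824 * s - 1528) / 10377 * (d^2)^2 - 2 * ((559 * s - 2559) / 10377) * ((c^2) * (d^2)) + (1265 * s - 6913) / 27672 * (c^2)^2"
  proof (rule weighted_square)
    show "(824 * s - 1528) / 10377 * ((9 - s) / 16) = (559 * s - 2559) / 10377" using ss by (simp add: field_simps)
    show "(559 * s - 2559) / 10377 * ((9 - s) / 16) = (1265 * s - 6913) / 27672" using ss by (simp add: field_simps)
  qed
  have 7: "(s - 1) / 2 * (b*c - (1 + s) / 8 * (a*b))^2
      = (s - 1) / 2 * (b*c)^2 - 2 * (2) * ((a*b) * (b*c)) + (1 + s) / 4 * (a*b)^2"
  proof (rule weighted_square)
    show "(s - 1) / 2 * ((1 + s) / 8) = 2" using ss by (simp add: field_simps)
    show "2 * ((1 + s) / 8) = (1 + s) / 4" using ss by (simp add: field_simps)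
  qed
  have 8: "(30 + 2 * s) / 9 * (c*d - (15 - s) / 32 * (a*b))^2
      = (30 + 2 * s) / 9 * (c*d)^2 - 2 * (4/3) * ((a*b) * (c*d)) + (15 - s) / 24 * (a*b)^2"
  proof (rule weighted_square)
    show "(30 + 2 * s) / 9 * ((15 - s) / 32) = 4/3" using ss by (simp add: field_simps)
    show "4/3 * ((15 - s) / 32) = (15 - s) / 24" using ss by (simp add: field_simps)
  qed
  have 9: "(9 + s) / 18 * (a*d - (9 - s) / 8 * (b*c))^2
      = (9 + s) / 18 * (a*d)^2 - 2 * (1/3) * ((b*c) * (a*d)) + (9 - s) / 24 * (b*c)^2"
  proof (rule weighted_square)
    show "(9 + s) / 18 * ((9 - s) / 8) = 1/3" using ss by (simp add: field_simps)
    show "1/3 * ((9 - s) / 8) = (9 - s) / 24" using ss by (simp add: field_simps)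
  qed
  have prods: "(a*d + b*c)^2 = a^2*d^2 + 2*(a*b*c*d) + b^2*c^2"
    "(2*a*c + b^2)^2 = 4*(a^2*c^2) + 4*(a*b*b*c) + (b^2)^2"
    "(a*c - 2*b*d)^2 = a^2*c^2 - 4*(a*b*c*d) + 4*(b^2*d^2)"
    "(a*b)^2 = a^2*b^2" "(b*c)^2 = b^2*c^2" "(c*d)^2 = c^2*d^2" "(a*d)^2 = a^2*d^2"
    "(a*b)*(b*c) = a*b*b*c" "(a*b)*(c*d) = a*b*c*d" "(b*c)*(a*d) = a*b*c*d"
    by (simp_all add: power2_eq_square algebra_simps)
  show ?thesis
    unfolding 1 2 3 4 5 6 7 8 9 prods
    using quartic_sos_reduced[of s "a^2" "b^2" "c^2" "d^2" "a*b*c*d" "a*b*b*c"]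
    by simp
qed

lemma sqrt33: "sqrt 33 * sqrt 33 = 33" "5 < sqrt 33" "sqrt 33 < 6"
  by (auto intro!: real_less_rsqrt real_less_lsqrt)

definition max_coeff :: real where
  "max_coeff = sqrt (2 * (1103 + 33 * sqrt 33) / 1153)"

lemma max_coeff_pos: "max_coeff > 0"
  unfolding max_coeff_def using sqrt33 by simp

lemma max_coeff_square: "max_coeff^2 = 2 * (1103 + 33 * sqrt 33) / 1153"
  unfolding max_coeff_def using sqrt33 by simp

text \<open>
  The left-hand side is the squared length of the gradient, up to a factor, of the cubic form
  \<open>3 a\<^sup>2 d + 6 a b c + b\<^sup>3\<close>, the coefficient of \<open>z\<^sup>3\<close> in \<open>(a + b z + c z\<^sup>2 + d z\<^sup>3)\<^sup>3\<close>. For the equality case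
  the three squares that compare \<open>b\<^sup>2\<close>, \<open>c\<^sup>2\<close>, \<open>d\<^sup>2\<close> with \<open>a\<^sup>2\<close> suffice, their weights being positive.
\<close>

lemma quartic_bound:
  fixes a b c d :: real
  shows "4 * (a*d + b*c)^2 + (2*a*c + b^2)^2 + 4 * (a*b)^2 + (a^2)^2
     \<le> max_coeff^2 * (a^2 + b^2 + c^2 + d^2)^2"
    and "4 * (a*d + b*c)^2 + (2*a*c + b^2)^2 + 4 * (a*b)^2 + (a^2)^2
     = max_coeff^2 * (a^2 + b^2 + c^2 + d^2)^2 \<Longrightarrow>
     b^2 = (9 + sqrt 33)/12 * a^2 \<and> c^2 = (17 + sqrt 33)/32 * a^2 \<and> d^2 = (15 - sqrt 33)/64 * a^2"
proof -
  define s where "s = sqrt 33"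
  have s: "s * s = 33" "5 < s" "s < 6"
    unfolding s_def using sqrt33 by auto
  define w1 w2 w3 where
    "w1 = (7309 - 235 * s) / 9224" and
    "w2 = (183743 - 22735 * s) / 110688" and
    "w3 = (14108 - 364 * s) / 10377"
  define x1 x2 x3 where
    "x1 = b^2 - (9 + s)/12 * a^2" and
    "x2 = c^2 - (17 + s)/32 * a^2" and
    "x3 = d^2 - (15 - s)/64 * a^2"
  define R where "R = (55685 + 24011 * s) / 110688 * (c^2 - (15 - s)/16 * b^2)^2
   + (7274 + 134 * s) / 10377 * (d^2 - (21 - 3 * s)/32 * b^2)^2
   + (824 * s - 1528) / 10377 * (d^2 - (9 - s)/16 * c^2)^2
   + 7/6 * (a*c - 2*b*d)^2
   + (s - 1)/2 * (b*c - (1 + s)/8 * (a*b))^2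
   + (30 + 2 * s)/9 * (c*d - (15 - s)/32 * (a*b))^2
   + (9 + s)/18 * (a*d - (9 - s)/8 * (b*c))^2"
  have w: "w1 > 0" "w2 > 0" "w3 > 0"
    using s unfolding w1_def w2_def w3_def by auto
  have R: "R \<ge> 0"
    unfolding R_def using s by (intro add_nonneg_nonneg mult_nonneg_nonneg) auto
  have sos: "max_coeff^2 * (a^2 + b^2 + c^2 + d^2)^2
     - (4 * (a*d + b*c)^2 + (2*a*c + b^2)^2 + 4 * (a*b)^2 + (a^2)^2)
     = w1 * x1^2 + w2 * x2^2 + w3 * x3^2 + R"
    unfolding max_coeff_square s_def[symmetric] quartic_sos[OF s(1)]
      w1_def w2_def w3_def x1_def x2_def x3_def R_def by simp
  have nn: "w1 * x1^2 \<ge> 0" "w2 * x2^2 \<ge> 0" "w3 * x3^2 \<ge> 0"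
    using w by simp_all
  show "4 * (a*d + b*c)^2 + (2*a*c + b^2)^2 + 4 * (a*b)^2 + (a^2)^2
     \<le> max_coeff^2 * (a^2 + b^2 + c^2 + d^2)^2"
    using sos nn R by linarith
  assume "4 * (a*d + b*c)^2 + (2*a*c + b^2)^2 + 4 * (a*b)^2 + (a^2)^2
     = max_coeff^2 * (a^2 + b^2 + c^2 + d^2)^2"
  then have "w1 * x1^2 = 0" "w2 * x2^2 = 0" "w3 * x3^2 = 0"
    using sos nn R by linarith+
  then have "x1 = 0" "x2 = 0" "x3 = 0"
    using w by auto
  then show "b^2 = (9 + sqrt 33)/12 * a^2 \<and> c^2 = (17 + sqrt 33)/32 * a^2 \<and> d^2 = (15 - sqrt 33)/64 * a^2"
    unfolding x1_def x2_def x3_def s_def by auto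
qed

section \<open>The third coefficient as a trilinear form\<close>

text \<open>
  The coefficient of \<open>z\<^sup>3\<close> in \<open>u(z) v(z)\<^sup>2\<close>, where \<open>u\<close> and \<open>v\<close> are given by their coefficient sequences.
\<close>

definition cubic_coeff :: "(nat \<Rightarrow> complex) \<Rightarrow> (nat \<Rightarrow> complex) \<Rightarrow> complex" where
  "cubic_coeff u v = u 0 * (2 * v 0 * v 3 + 2 * v 1 * v 2) + u 1 * (2 * v 0 * v 2 + v 1 ^ 2)
     + u 2 * (2 * v 0 * v 1) + u 3 * v 0 ^ 2"

text \<open>
  The coefficients, for \<open>k < 4\<close>, of the cube root of the extremal function.
\<close>

definition extremal_coeff :: "nat \<Rightarrow> real" where
  "extremal_coeff k = sqrt ((483 - 19 * sqrt 33) / 1153) *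
     [1, sqrt (3 + 1/3 * sqrt 33) / 2, (1 + sqrt 33) / 8, sqrt (15 - sqrt 33) / 8] ! k"

lemma extremal_coeff_pos: "k < 4 \<Longrightarrow> extremal_coeff k > 0"
  unfolding extremal_coeff_def using sqrt33 by (auto simp: less_Suc_eq numeral_eq_Suc)

lemma extremal_coeff_squares:
  "extremal_coeff 0 ^ 2 = (483 - 19 * sqrt 33) / 1153"
  "extremal_coeff 1 ^ 2 = (9 + sqrt 33)/12 * extremal_coeff 0 ^ 2"
  "extremal_coeff 2 ^ 2 = (17 + sqrt 33)/32 * extremal_coeff 0 ^ 2"
  "extremal_coeff 3 ^ 2 = (15 - sqrt 33)/64 * extremal_coeff 0 ^ 2"
proof -
  have c2: "(1 + sqrt 33) * (1 + sqrt 33) = 34 + sqrt 33 * 2"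
    by (simp add: ring_distribs)
  have c: "((1 + sqrt 33) / 8)^2 = (17 + sqrt 33) / 32"
    by (simp add: power2_eq_square c2)
  show "extremal_coeff 0 ^ 2 = (483 - 19 * sqrt 33) / 1153"
    "extremal_coeff 1 ^ 2 = (9 + sqrt 33)/12 * extremal_coeff 0 ^ 2"
    "extremal_coeff 2 ^ 2 = (17 + sqrt 33)/32 * extremal_coeff 0 ^ 2"
    "extremal_coeff 3 ^ 2 = (15 - sqrt 33)/64 * extremal_coeff 0 ^ 2"
    using sqrt33 by (simp_all add: extremal_coeff_def power_mult_distrib power_divide c c2
        numeral_eq_Suc[of "num.Bit1 num.One"] numeral_eq_Suc[of "num.Bit0 num.One"] del: numeral_eq_Suc
        split: if_splits)
qed

lemma sum_lessThan_4: "(\<Sum>k<4. f k) = f 0 + f 1 + f 2 + f (3::nat)"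
  by (simp add: eval_nat_numeral)

lemma extremal_coeff_sum: "(\<Sum>k<4. extremal_coeff k ^ 2) = 1"
  unfolding sum_lessThan_4 extremal_coeff_squares(2-4) unfolding extremal_coeff_squares(1)
  using sqrt33(1) by (simp add: field_simps)

text \<open>
  The equations of Lagrange for the cubic form on the unit sphere, with \<open>max_coeff\<close> as (rescaled)
  multiplier. Write \<open>a\<close>, \<open>b\<close>, \<open>c\<close>, \<open>d\<close> for the coefficients and \<open>K\<close> for the multiplier. Although
  \<open>b\<close> and \<open>d\<close> involve nested radicals, \<open>2 b d = a c\<close>, and this together with
  \<open>K d = a\<^sup>2\<close> brings the other three equations down to identities in \<open>\<rat>(\<surd>33)\<close>.
\<close>

lemma extremal_coeff_stationary:
  shows "2 * extremal_coeff 0 * extremal_coeff 3 + 2 * extremal_coeff 1 * extremal_coeff 2 = max_coeff * extremal_coeff 0"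
    and "2 * extremal_coeff 0 * extremal_coeff 2 + extremal_coeff 1 ^ 2 = max_coeff * extremal_coeff 1"
    and "2 * extremal_coeff 0 * extremal_coeff 1 = max_coeff * extremal_coeff 2"
    and "extremal_coeff 0 ^ 2 = max_coeff * extremal_coeff 3"
proof -
  define s where "s = sqrt 33"
  have s: "s * s = 33" "5 < s" "s < 6"
    unfolding s_def using sqrt33 by auto
  define a b c d K where "a = extremal_coeff 0" and "b = extremal_coeff 1" and "c = extremal_coeff 2" and "d = extremal_coeff 3"
    and "K = max_coeff"
  have pos: "a > 0" "b > 0" "c > 0" "d > 0"
    unfolding a_def b_def c_def d_def by (auto intro: extremal_coeff_pos)
  have K: "K > 0" "K^2 = 2 * (1103 + 33 * s) / 1153"
    unfolding K_def s_def using max_coeff_pos max_coeff_square by auto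
  have sq: "a^2 = (483 - 19 * s) / 1153" "b^2 = (9 + s)/12 * a^2" "c^2 = (17 + s)/32 * a^2" "d^2 = (15 - s)/64 * a^2"
    unfolding a_def b_def c_def d_def s_def using extremal_coeff_squares by simp_all
  have c: "c = (1 + s) / 8 * a"
    unfolding a_def c_def s_def extremal_coeff_def by simp
  have "(2 * (b * d))^2 = (a * c)^2"
  proof -
    have "(2 * (b * d))^2 = 4 * ((9 + s)/12 * ((15 - s)/64)) * (a^2 * a^2)"
      by (simp add: power_mult_distrib sq(2,4))
    also have "4 * ((9 + s)/12 * ((15 - s)/64)) = (17 + s)/32"
      using s(1) by (simp add: field_simps)
    finally show ?thesis
      by (simp add: power_mult_distrib sq(3))
  qed
  then have bd: "2 * (b * d) = a * c"
    by (rule power2_eq_imp_eq) (use pos in auto)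
  have "(K * d)^2 = (a^2)^2"
  proof -
    have "(K * d)^2 = (2 * (1103 + 33 * s) / 1153 * ((15 - s)/64)) * a^2"
      by (simp add: power_mult_distrib K sq(4))
    also have "2 * (1103 + 33 * s) / 1153 * ((15 - s)/64) = (483 - 19 * s) / 1153"
      using s(1) by (simp add: field_simps)
    finally have "(K * d)^2 = a^2 * a^2"
      unfolding sq(1)[symmetric] .
    then show ?thesis
      by (simp only: power2_eq_square)
  qed
  then have Kd: "K * d = a^2"
    by (rule power2_eq_imp_eq) (use pos K in auto)
  have "(K * c) * a = (2 * a * b) * a"
    using bd Kd by algebra
  then have Kc: "K * c = 2 * a * b"
    using pos by simp
  have "(K * b) * (2 * b * d) = (2 * a * c + b^2) * (2 * b * d)"
  proof -
    have e: "2 * b^2 = 2 * c^2 + (1 + s)/8 * b^2"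
    proof -
      have e0: "2 * ((9 + s)/12) = 2 * ((17 + s)/32) + (1 + s)/8 * ((9 + s)/12)"
        using s(1) by (simp add: field_simps)
      have "2 * b^2 = (2 * ((9 + s)/12)) * a^2"
        by (simp only: sq(2) mult.assoc)
      also have "\<dots> = 2 * c^2 + (1 + s)/8 * b^2"
        unfolding e0 by (simp only: sq(2,3) distrib_right mult.assoc)
      finally show ?thesis .
    qed
    have "(K * b) * (2 * b * d) = a^2 * (2 * b^2)"
      using Kd by algebra
    also have "\<dots> = 2 * a^2 * c^2 + a * ((1 + s)/8 * a) * b^2"
      unfolding e by (simp add: power2_eq_square algebra_simps)
    also have "\<dots> = 2 * a^2 * c^2 + a * c * b^2"
      unfolding c by simp
    also have "\<dots> = (2 * a * c + b^2) * (2 * b * d)"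
      using bd by algebra
    finally show ?thesis .
  qed
  then have Kb: "K * b = 2 * a * c + b^2"
    using pos by simp
  have "(K * a) * d = (2 * a * d + 2 * b * c) * d"
  proof -
    have "2 * d^2 + c^2 = (2 * ((15 - s)/64) + (17 + s)/32) * a^2"
      unfolding sq(3,4) by (simp add: algebra_simps)
    also have "\<dots> = a^2"
      by (simp add: field_simps)
    finally have "2 * d^2 + c^2 = a^2" .
    then show ?thesis
      using Kd bd by algebra
  qed
  then have Ka: "K * a = 2 * a * d + 2 * b * c"
    using pos by simp
  show "2 * extremal_coeff 0 * extremal_coeff 3 + 2 * extremal_coeff 1 * extremal_coeff 2 = max_coeff * extremal_coeff 0"
    "2 * extremal_coeff 0 * extremal_coeff 2 + extremal_coeff 1 ^ 2 = max_coeff * extremal_coeff 1"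
    "2 * extremal_coeff 0 * extremal_coeff 1 = max_coeff * extremal_coeff 2"
    "extremal_coeff 0 ^ 2 = max_coeff * extremal_coeff 3"
    using Ka Kb Kc Kd unfolding a_def b_def c_def d_def K_def by simp_all
qed


text \<open>
  Euler's identity for the homogeneous cubic form: its value on the unit sphere at a stationary point
  is the multiplier.
\<close>

lemma extremal_coeff_cubic_real:
  "extremal_coeff 0 * (2 * extremal_coeff 0 * extremal_coeff 3 + 2 * extremal_coeff 1 * extremal_coeff 2)
     + extremal_coeff 1 * (2 * extremal_coeff 0 * extremal_coeff 2 + extremal_coeff 1 ^ 2)
     + extremal_coeff 2 * (2 * extremal_coeff 0 * extremal_coeff 1) + extremal_coeff 3 * extremal_coeff 0 ^ 2 = max_coeff"
proof -
  have "max_coeff * (\<Sum>k<4. extremal_coeff k ^ 2) = max_coeff" by (simp add: extremal_coeff_sum)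
  then show ?thesis
    unfolding extremal_coeff_stationary by (simp add: sum_lessThan_4 power2_eq_square algebra_simps)
qed

text \<open>
  One third of the gradient of the cubic form that sends \<open>x\<close> to the coefficient of \<open>z\<^sup>3\<close> in the cube of
  \<open>x\<^sub>0 + x\<^sub>1 z + x\<^sub>2 z\<^sup>2 + x\<^sub>3 z\<^sup>3\<close>; for complex \<open>v\<close>, \<open>cubic_coeff u v\<close> pairs \<open>u\<close> with the same
  expressions in \<open>v\<close>.
\<close>

definition cubic_gradient :: "(nat \<Rightarrow> real) \<Rightarrow> nat \<Rightarrow> real" where
  "cubic_gradient x k =
     [2 * x 0 * x 3 + 2 * x 1 * x 2, 2 * x 0 * x 2 + x 1 ^ 2, 2 * x 0 * x 1, x 0 ^ 2] ! k"

lemma cubic_coeff_norm_le: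
  fixes u v :: "nat \<Rightarrow> complex"
  shows "cmod (cubic_coeff u v) \<le> (\<Sum>k<4. cmod (u k) * cubic_gradient (\<lambda>k. cmod (v k)) k)"
proof -
  have "cmod (2 * v 0 * v 3 + 2 * v 1 * v 2) \<le> 2 * cmod (v 0) * cmod (v 3) + 2 * cmod (v 1) * cmod (v 2)"
    by (rule order_trans[OF norm_triangle_ineq]) (simp add: norm_mult)
  moreover have "cmod (2 * v 0 * v 2 + v 1 ^ 2) \<le> 2 * cmod (v 0) * cmod (v 2) + cmod (v 1) ^ 2"
    by (rule order_trans[OF norm_triangle_ineq]) (simp add: norm_mult norm_power)
  ultimately have "cmod (u 0 * (2 * v 0 * v 3 + 2 * v 1 * v 2)) + cmod (u 1 * (2 * v 0 * v 2 + v 1 ^ 2))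
      + cmod (u 2 * (2 * v 0 * v 1)) + cmod (u 3 * v 0 ^ 2) \<le> cmod (u 0) *
     (2 * cmod (v 0) * cmod (v 3) + 2 * cmod (v 1) * cmod (v 2)) +
     cmod (u 1) * (2 * cmod (v 0) * cmod (v 2) + cmod (v 1) ^ 2) +
     cmod (u 2) * (2 * cmod (v 0) * cmod (v 1)) + cmod (u 3) * cmod (v 0) ^ 2"
    unfolding norm_mult[of "u _"]
    by (intro add_mono mult_left_mono) (auto simp: norm_mult norm_power)
  moreover have "cmod (p + q + r + t) \<le> cmod p + cmod q + cmod r + cmod t" for p q r t
    by (meson add_mono norm_triangle_ineq norm_triangle_le order_refl)
  ultimately show ?thesis
    unfolding sum_lessThan_4 cubic_coeff_def cubic_gradient_def by (simp, meson order_trans)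
qed

lemma gradient_square_sum:
  "(\<Sum>k<4. cubic_gradient x k ^ 2) =
     4 * (x 0*x 3 + x 1*x 2)^2 + (2*x 0*x 2 + x 1^2)^2 + 4 * (x 0*x 1)^2 + (x 0^2)^2"
  by (simp add: cubic_gradient_def sum_lessThan_4 power2_eq_square algebra_simps)

text \<open>
  Passing to moduli only increases the form, Cauchy--Schwarz separates \<open>u\<close> from \<open>v\<close>, and the
  remaining factor is bounded by the quartic inequality.
\<close>

theorem cubic_coeff_bound:
  fixes u v :: "nat \<Rightarrow> complex"
  shows "cmod (cubic_coeff u v) \<le> max_coeff * sqrt (\<Sum>k<4. cmod (u k) ^ 2) * (\<Sum>k<4. cmod (v k) ^ 2)"
proof -
  define x where "x = (\<lambda>k. cmod (v k))"
  define q where "q = cubic_gradient x"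
  have q2: "(\<Sum>k<4. q k ^ 2) \<le> max_coeff^2 * (\<Sum>k<4. x k ^ 2)^2"
    unfolding q_def gradient_square_sum
    using quartic_bound(1)[of "x 0" "x 3" "x 1" "x 2"] by (simp add: sum_lessThan_4)
  have "cmod (cubic_coeff u v) \<le> (\<Sum>k<4. cmod (u k) * q k)"
    using cubic_coeff_norm_le unfolding q_def x_def .
  moreover have "(\<Sum>k<4. cmod (u k) * q k)^2 \<le> (\<Sum>k<4. cmod (u k)^2) * (\<Sum>k<4. q k ^ 2)"
    by (rule Cauchy_Schwarz_ineq_sum)
  ultimately have "(cmod (cubic_coeff u v))^2 \<le> (\<Sum>k<4. cmod (u k)^2) * (max_coeff^2 * (\<Sum>k<4. x k ^ 2)^2)"
    using q2 by (smt (verit, best) mult_left_mono norm_ge_zero power_mono sum_nonneg zero_le_power2)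
  also have "\<dots> = (max_coeff * sqrt (\<Sum>k<4. cmod (u k) ^ 2) * (\<Sum>k<4. cmod (v k) ^ 2))^2"
    by (simp add: power_mult_distrib sum_nonneg x_def)
  finally show ?thesis
    by (rule power2_le_imp_le) (use max_coeff_pos in \<open>simp add: sum_nonneg\<close>)
qed

text \<open>
  If the bound is attained, the triangle inequality, Cauchy--Schwarz and the quartic inequality are all
  equalities. The quartic inequality fixes the moduli of \<open>v\<close>, Cauchy--Schwarz makes the moduli of
  \<open>u\<close> proportional to the gradient there, hence equal to those of \<open>v\<close> by the stationarity equations,
  and the triangle inequality makes all six terms of the form positive. The latter determines every
  phase from those of \<open>v\<^sub>0\<close> and \<open>v\<^sub>1\<close>. The parameter \<open>\<phi>\<close> cancels in the product \<open>u v v\<close>, while \<open>\<theta>\<close>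
  is a rotation of the disc.
\<close>

theorem cubic_coeff_equality:
  fixes u v :: "nat \<Rightarrow> complex"
  assumes u: "(\<Sum>k<4. cmod (u k) ^ 2) \<le> 1" and v: "(\<Sum>k<4. cmod (v k) ^ 2) \<le> 1"
    and eq: "cubic_coeff u v = of_real max_coeff"
  obtains \<phi> \<theta> where "\<And>k. k < 4 \<Longrightarrow> u k = cis (- 2 * \<phi> - 3 * \<theta>) * cis (k * \<theta>) * extremal_coeff k"
    "\<And>k. k < 4 \<Longrightarrow> v k = cis \<phi> * cis (k * \<theta>) * extremal_coeff k"
proof -
  define K where "K = max_coeff"
  have K: "K > 0" by (simp add: K_def max_coeff_pos)
  define x where "x = (\<lambda>k. cmod (v k))"
  define y where "y = (\<lambda>k. cmod (u k))"
  define q where "q = cubic_gradient x"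
  have xnn: "x k \<ge> 0" for k by (simp add: x_def)
  define X where "X = (\<Sum>k<4. x k ^ 2)"
  have X: "0 \<le> X" "X \<le> 1" using v by (auto simp: X_def x_def sum_nonneg)
  have q2: "(\<Sum>k<4. q k ^ 2) \<le> K^2 * X^2"
    unfolding q_def gradient_square_sum X_def K_def
    using quartic_bound(1)[of "x 0" "x 3" "x 1" "x 2"] by (simp add: sum_lessThan_4)
  have X2: "X^2 \<le> 1" using X by (simp add: power_le_one)
  have Kle: "K \<le> (\<Sum>k<4. y k * q k)"
    using cubic_coeff_norm_le[of u v] eq K unfolding q_def x_def y_def K_def by simp
  \<comment> \<open>The defect in Cauchy--Schwarz, written as a sum of squares, is at most \<open>K\<^sup>2 (X\<^sup>2 - 1) \<le> 0\<close>.\<close>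
  have "(\<Sum>k<4. (K * y k - q k)^2) = K^2 * (\<Sum>k<4. y k ^ 2) - 2 * K * (\<Sum>k<4. y k * q k) + (\<Sum>k<4. q k ^ 2)"
    unfolding sum_lessThan_4 by (simp add: power2_eq_square algebra_simps)
  also have "\<dots> \<le> K^2 * 1 - 2 * K * K + K^2 * X^2"
    using u q2 Kle K unfolding y_def by (intro add_mono diff_mono mult_left_mono) auto
  also have "\<dots> = K^2 * (X^2 - 1)" by (simp add: power2_eq_square algebra_simps)
  finally have le: "(\<Sum>k<4. (K * y k - q k)^2) \<le> K^2 * (X^2 - 1)" .
  have "0 \<le> (\<Sum>k<4. (K * y k - q k)^2)" by (simp add: sum_nonneg)
  then have "0 \<le> K^2 * (X^2 - 1)" using le by linarith
  then have "X^2 = 1" using X2 K by (simp add: zero_le_mult_iff)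
  then have X1: "X = 1" using X by (simp add: power2_eq_1_iff)
  have "(\<Sum>k<4. (K * y k - q k)^2) \<le> 0" using le X1 by simp
  then have "(\<Sum>k<4. (K * y k - q k)^2) = 0" by (simp add: sum_nonneg order_antisym)
  then have yq: "K * y k = q k" if "k < 4" for k
    using that by (simp add: sum_nonneg_eq_0_iff)
  have "K * (\<Sum>k<4. y k * q k) = (\<Sum>k<4. q k ^ 2)"
    unfolding sum_distrib_left by (intro sum.cong) (auto simp: power2_eq_square yq[symmetric])
  then have "K^2 \<le> (\<Sum>k<4. q k ^ 2)"
    using Kle K by (metis mult_left_mono less_imp_le power2_eq_square)
  then have "(\<Sum>k<4. q k ^ 2) = K^2 * X^2"
    using q2 X1 by simp
  then have sq: "x 1^2 = (9 + sqrt 33)/12 * x 0^2" "x 2^2 = (17 + sqrt 33)/32 * x 0^2" "x 3^2 = (15 - sqrt 33)/64 * x 0^2"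
    using quartic_bound(2)[of "x 0" "x 3" "x 1" "x 2"]
    unfolding X_def K_def q_def gradient_square_sum by (simp_all add: sum_lessThan_4)
  have "extremal_coeff 0 ^ 2 * X = x 0^2 * (\<Sum>k<4. extremal_coeff k ^ 2)"
    unfolding X_def sum_lessThan_4 sq extremal_coeff_squares(2-4) by (simp add: algebra_simps)
  then have x0: "x 0 ^ 2 = extremal_coeff 0 ^ 2" using X1 extremal_coeff_sum by simp
  have x: "x k = extremal_coeff k" if "k < 4" for k
  proof -
    have "x k ^ 2 = extremal_coeff k ^ 2"
      using that sq x0 extremal_coeff_squares(2-4) by (auto simp: less_Suc_eq eval_nat_numeral)
    then show ?thesis
      by (rule power2_eq_imp_eq) (use xnn extremal_coeff_pos that in \<open>auto simp: less_imp_le\<close>)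
  qed
  have y: "y k = extremal_coeff k" if "k < 4" for k
  proof -
    have "q k = K * extremal_coeff k"
      using that extremal_coeff_stationary x unfolding q_def K_def cubic_gradient_def
      by (auto simp: less_Suc_eq eval_nat_numeral)
    then show ?thesis using yq[OF that] K by simp
  qed
  define G where "G = extremal_coeff"
  have G: "G k > 0" if "k < 4" for k using extremal_coeff_pos[OF that] by (simp add: G_def)
  have nm: "cmod (u k) = G k" "cmod (v k) = G k" if "k < 4" for k
    using x[OF that] y[OF that] by (auto simp: x_def y_def G_def)
  have re: "Re (w) \<le> cmod w" for w by (rule complex_Re_le_cmod)
  have Re_comb: "Re (2 * a + 2 * b + 2 * c + d + 2 * e + f) = 2 * Re a + 2 * Re b + 2 * Re c + Re d + 2 * Re e + Re f"
    for a b c d e f by simp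
  have eqRe: "2 * Re (u 0 * v 0 * v 3) + 2 * Re (u 0 * v 1 * v 2) + 2 * Re (u 1 * v 0 * v 2)
      + Re (u 1 * v 1 ^ 2) + 2 * Re (u 2 * v 0 * v 1) + Re (u 3 * v 0 ^ 2) = K"
  proof -
    have "K = Re (cubic_coeff u v)" by (simp add: eq K_def)
    also have "cubic_coeff u v = 2 * (u 0 * v 0 * v 3) + 2 * (u 0 * v 1 * v 2) + 2 * (u 1 * v 0 * v 2)
      + (u 1 * v 1 ^ 2) + 2 * (u 2 * v 0 * v 1) + (u 3 * v 0 ^ 2)"
      by (simp add: cubic_coeff_def algebra_simps)
    finally show ?thesis unfolding Re_comb by (rule sym)
  qed
  have eqG: "2 * (G 0 * G 0 * G 3) + 2 * (G 0 * G 1 * G 2) + 2 * (G 1 * G 0 * G 2)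
      + (G 1 * G 1 ^ 2) + 2 * (G 2 * G 0 * G 1) + (G 3 * G 0 ^ 2) = K"
    using extremal_coeff_cubic_real by (simp add: K_def G_def power2_eq_square algebra_simps)
  have full: "w = of_real (cmod w)" if "Re w \<ge> cmod w" for w
  proof -
    have "Re w = cmod w" using that re[of w] by simp
    then have "Im w = 0" using cmod_power2[of w] by simp
    then show ?thesis using \<open>Re w = cmod w\<close> by (simp add: complex_eq_iff)
  qed
  \<comment> \<open>A weighted sum of real parts that equals the weighted sum of the moduli forces every term to
    be a nonnegative real number.\<close>
  have all_full: "w1 = cmod w1 \<and> w2 = cmod w2 \<and> w3 = cmod w3 \<and> w4 = cmod w4 \<and> w5 = cmod w5 \<and> w6 = cmod w6"
    if "2 * Re w1 + 2 * Re w2 + 2 * Re w3 + Re w4 + 2 * Re w5 + Re w6 =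
        2 * cmod w1 + 2 * cmod w2 + 2 * cmod w3 + cmod w4 + 2 * cmod w5 + cmod w6"
    for w1 w2 w3 w4 w5 w6
    using that re[of w1] re[of w2] re[of w3] re[of w4] re[of w5] re[of w6]
    by (intro conjI full) linarith+
  have norms: "cmod (u 0 * v 0 * v 3) = G 0 * G 0 * G 3" "cmod (u 0 * v 1 * v 2) = G 0 * G 1 * G 2"
    "cmod (u 1 * v 0 * v 2) = G 1 * G 0 * G 2" "cmod (u 1 * v 1 ^ 2) = G 1 * G 1 ^ 2"
    "cmod (u 2 * v 0 * v 1) = G 2 * G 0 * G 1" "cmod (u 3 * v 0 ^ 2) = G 3 * G 0 ^ 2"
    by (simp_all add: norm_mult norm_power nm)
  have t: "u 0 * v 0 * v 3 = G 0 * G 0 * G 3" "u 0 * v 1 * v 2 = G 0 * G 1 * G 2"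
    "u 1 * v 0 * v 2 = G 1 * G 0 * G 2" "u 1 * v 1 ^ 2 = G 1 * G 1 ^ 2"
    "u 2 * v 0 * v 1 = G 2 * G 0 * G 1" "u 3 * v 0 ^ 2 = G 3 * G 0 ^ 2"
    using all_full[OF eqRe[folded eqG, folded norms]] unfolding norms by simp_all
  define \<phi> where "\<phi> = Arg (v 0)"
  define \<theta> where "\<theta> = Arg (v 1) - \<phi>"
  have G0: "complex_of_real (G k) \<noteq> 0" if "k < 4" for k using G[OF that] by simp
  have polar: "w = cmod w * cis (Arg w)" for w
    by (metis rcis_cmod_Arg rcis_def)
  have v0: "v 0 = cis \<phi> * G 0"
    using polar[of "v 0"] by (simp add: nm \<phi>_def mult.commute)
  have v1: "v 1 = cis \<phi> * cis \<theta> * G 1"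
    using polar[of "v 1"] by (simp add: nm \<theta>_def cis_mult mult.commute)
  define z where "z = cis \<phi>"
  define w where "w = cis \<theta>"
  have zw: "z \<noteq> 0" "w \<noteq> 0" by (auto simp: z_def w_def)
  \<comment> \<open>The terms are now solved one after the other, each containing a single unknown coefficient.\<close>
  note nz = zw G0[of 0, simplified] G0[of 1, simplified] G0[of 2, simplified] G0[of 3, simplified]
  have V: "v 0 = z * G 0" "v 1 = z * w * G 1" using v0 v1 by (auto simp: z_def w_def)
  have U3: "u 3 = G 3 / z^2" using t(6) nz unfolding V by (simp add: field_simps power2_eq_square)
  have U1: "u 1 = G 1 / (z * w)^2" using t(4) nz unfolding V by (simp add: field_simps power2_eq_square)
  have U2: "u 2 = G 2 / (z^2 * w)" using t(5) nz unfolding V by (simp add: field_simps power2_eq_square)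
  have V2: "v 2 = z * w^2 * G 2" using t(3) nz unfolding V U1 by (simp add: field_simps power2_eq_square)
  have U0: "u 0 = G 0 / (z^2 * w^3)" using t(2) nz unfolding V V2 by (simp add: field_simps power2_eq_square power3_eq_cube)
  have V3: "v 3 = z * w^3 * G 3" using t(1) nz unfolding V U0 by (simp add: field_simps power2_eq_square power3_eq_cube)
  have pw: "cis (real k * \<theta>) = w ^ k" for k by (simp add: w_def Complex.DeMoivre)
  have pz: "cis (- 2 * \<phi> - 3 * \<theta>) = 1 / (z^2 * w^3)"
  proof -
    have "cis (- 2 * \<phi> - 3 * \<theta>) * (z^2 * w^3) = 1"
      by (simp add: z_def w_def Complex.DeMoivre cis_mult)
    then show ?thesis using zw by (simp add: field_simps)
  qed
  show thesis
  proof (rule that[of \<phi> \<theta>])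
    fix k :: nat assume "k < 4"
    then have k: "k = 0 \<or> k = 1 \<or> k = 2 \<or> k = 3" by auto
    show "u k = cis (- 2 * \<phi> - 3 * \<theta>) * cis (k * \<theta>) * extremal_coeff k"
      using k zw unfolding pw pz G_def[symmetric]
      by (elim disjE) (simp_all add: U0 U1[unfolded One_nat_def] U2 U3 field_simps power2_eq_square power3_eq_cube)
    show "v k = cis \<phi> * cis (k * \<theta>) * extremal_coeff k"
      using k zw unfolding pw G_def[symmetric] z_def[symmetric]
      by (elim disjE) (simp_all add: V[unfolded One_nat_def] V2 V3)
  qed
qed

section \<open>Bessel's inequality on the unit circle\<close>

lemma sums_imp_has_fps_expansion:
  fixes c :: "nat \<Rightarrow> complex"
  assumes \<rho>: "\<rho> > 0" and sums: "\<And>z. z \<in> ball 0 \<rho> \<Longrightarrow> (\<lambda>n. c n * z ^ n) sums F z"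
  shows "F has_fps_expansion Abs_fps c"
proof -
  have "conv_radius c \<ge> ereal \<rho>"
  proof (rule conv_radius_geI_ex')
    fix r :: real assume "0 < r" "ereal r < ereal \<rho>"
    then show "summable (\<lambda>n. c n * of_real r ^ n)"
      using sums[of "of_real r"] by (auto simp: sums_iff)
  qed
  then have "fps_conv_radius (Abs_fps c) > 0"
    using \<rho> unfolding fps_conv_radius_def
    by (simp, meson ereal_less(2) less_le_trans)
  moreover have "eventually (\<lambda>z. z \<in> ball 0 \<rho>) (nhds 0)"
    using \<rho> by (intro eventually_nhds_in_open) auto
  then have "eventually (\<lambda>z. eval_fps (Abs_fps c) z = F z) (nhds 0)"
    by eventually_elim (use sums in \<open>auto simp: eval_fps_def sums_iff\<close>)
  ultimately show ?thesis
    by (simp add: has_fps_expansion_def)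
qed

lemma fps_expansion_polynomial:
  fixes c :: "nat \<Rightarrow> complex"
  shows "fps_expansion (\<lambda>z. \<Sum>k<n. c k * z ^ k) 0 = Abs_fps (\<lambda>k. if k < n then c k else 0)"
proof (rule fps_expansion_eqI, rule sums_imp_has_fps_expansion[of 1])
  fix z :: complex
  have "(\<lambda>k. if k \<in> {..<n} then c k * z ^ k else 0) sums (\<Sum>k<n. c k * z ^ k)"
    by (rule sums_If_finite_set) simp
  then show "(\<lambda>k. (if k < n then c k else 0) * z ^ k) sums (\<Sum>k<n. c k * z ^ k)"
    by (rule sums_cong[THEN iffD1, rotated]) auto
qed simp

text \<open>
  Cauchy's integral formula for derivatives on the unit circle, parametrized by the angle.
\<close>

lemma fourier_coefficient:
  assumes hol: "g holomorphic_on ball 0 \<rho>" and \<rho>: "\<rho> > 1"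
  shows "((\<lambda>t. g (cis t) * cnj (cis (real k * t))) has_integral 2 * pi * fps_nth (fps_expansion g 0) k) {0..2*pi}"
proof -
  have cont: "continuous_on (cball 0 1) g"
    by (rule continuous_on_subset[OF holomorphic_on_imp_continuous_on[OF hol]]) (use \<rho> in auto)
  have hol1: "g holomorphic_on ball 0 1"
    by (rule holomorphic_on_subset[OF hol]) (use \<rho> in auto)
  define I where "I = contour_integral (circlepath 0 1) (\<lambda>u. g u / (u - 0) ^ Suc k)"
  have "((\<lambda>u. g u / (u - 0) ^ Suc k) has_contour_integral I) (circlepath 0 1)"
    unfolding I_def
    by (rule has_contour_integral_integral,
        rule Cauchy_higher_derivative_integral_circlepath(1)[OF cont hol1]) simp
  then have "((\<lambda>t. g (cis t) / cis t ^ Suc k * \<i> * cis t) has_integral I) {0..2*pi}"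
    unfolding circlepath_def by (subst (asm) has_contour_integral_part_circlepath_iff) auto
  then have "((\<lambda>t. (1/\<i>) * (g (cis t) / cis t ^ Suc k * \<i> * cis t)) has_integral (1/\<i>) * I) {0..2*pi}"
    by (rule has_integral_mult_right)
  moreover have "(1/\<i>) * (g (cis t) / cis t ^ Suc k * \<i> * cis t) = g (cis t) * cnj (cis (real k * t))" for t
    by (simp add: cis_cnj field_simps Complex.DeMoivre flip: cis_inverse)
  moreover have "(1/\<i>) * I = 2 * pi * fps_nth (fps_expansion g 0) k"
  proof -
    have cancel: "(1/w) * I = p * (m / (p * w) * I / m)" if "w \<noteq> 0" "p \<noteq> 0" "m \<noteq> 0" for w p m :: complex
      using that by (simp add: field_simps)
    have "(deriv ^^ k) g 0 = fact k / (2 * pi * \<i>) * I"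
      unfolding I_def by (rule Cauchy_higher_derivative_integral_circlepath(2)[OF cont hol1]) simp
    then show ?thesis
      using cancel[of \<i> "of_real (2 * pi)" "fact k"] by (simp add: fps_expansion_def)
  qed
  ultimately show ?thesis by simp
qed

lemma inner_product_polynomial:
  assumes hol: "g holomorphic_on ball 0 \<rho>" and \<rho>: "\<rho> > 1"
  shows "((\<lambda>t. Re (g (cis t) * cnj (\<Sum>k<n. c k * cis t ^ k))) has_integral
           2 * pi * Re (\<Sum>k<n. fps_nth (fps_expansion g 0) k * cnj (c k))) {0..2*pi}"
proof -
  have "((\<lambda>t. \<Sum>k<n. cnj (c k) * (g (cis t) * cnj (cis (real k * t)))) has_integral
      (\<Sum>k<n. cnj (c k) * (2 * pi * fps_nth (fps_expansion g 0) k))) {0..2*pi}"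
    by (intro has_integral_sum has_integral_mult_right fourier_coefficient[OF hol \<rho>]) auto
  from has_integral_linear[OF this bounded_linear_Re]
  have "((\<lambda>t. Re (\<Sum>k<n. cnj (c k) * (g (cis t) * cnj (cis (real k * t))))) has_integral
      Re (\<Sum>k<n. cnj (c k) * (2 * pi * fps_nth (fps_expansion g 0) k))) {0..2*pi}"
    by (simp add: o_def)
  moreover have "(\<Sum>k<n. cnj (c k) * (g (cis t) * cnj (cis (real k * t)))) = g (cis t) * cnj (\<Sum>k<n. c k * cis t ^ k)" for t
    by (simp add: cnj_sum sum_distrib_left Complex.DeMoivre mult_ac)
  moreover have "(\<Sum>k<n. cnj (c k) * (2 * pi * fps_nth (fps_expansion g 0) k))
      = of_real (2 * pi) * (\<Sum>k<n. fps_nth (fps_expansion g 0) k * cnj (c k))"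
    by (simp add: sum_distrib_left mult_ac)
  ultimately show ?thesis
    by (simp only: Re_complex_of_real times_complex.sel Im_complex_of_real) simp
qed

lemma Re_mult_cnj_self: "Re (z * cnj z) = (cmod z)^2"
  by (metis complex_norm_square Re_complex_of_real)

text \<open>
  The previous formula applied to the polynomial itself.
\<close>

lemma parseval_polynomial:
  "((\<lambda>t. cmod (\<Sum>k<n. c k * cis t ^ k) ^ 2) has_integral 2 * pi * (\<Sum>k<n. cmod (c k) ^ 2)) {0..2*pi}"
proof -
  define p where "p = (\<lambda>z. \<Sum>k<n. c k * z ^ k)"
  have "p holomorphic_on ball 0 2"
    unfolding p_def by (intro holomorphic_intros)
  note X = inner_product_polynomial[OF this, where n = n and c = c]
  have "Re (p (cis t) * cnj (\<Sum>k<n. c k * cis t ^ k)) = cmod (\<Sum>k<n. c k * cis t ^ k) ^ 2" for t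
    by (simp only: p_def Re_mult_cnj_self)
  moreover have "Re (\<Sum>k<n. fps_nth (fps_expansion p 0) k * cnj (c k)) = (\<Sum>k<n. cmod (c k) ^ 2)"
    unfolding p_def fps_expansion_polynomial Re_sum by (simp add: Re_mult_cnj_self del: times_complex.sel)
  ultimately show ?thesis
    using X by simp
qed

text \<open>
  The pointwise inequality \<open>2 Re (g P\<^sup>*) - |P|\<^sup>2 \<le> |g|\<^sup>2\<close>, with \<open>P\<close> the Taylor polynomial of \<open>g\<close> and \<open>P\<^sup>*\<close>
  its conjugate, is integrated over the circle; no convergence of the Taylor series on the circle enters.
\<close>

lemma bessel_inequality:
  assumes hol: "g holomorphic_on ball 0 \<rho>" and \<rho>: "\<rho> > 1"
  shows "(\<Sum>k<n. cmod (fps_nth (fps_expansion g 0) k) ^ 2) \<le> integral {0..2*pi} (\<lambda>t. cmod (g (cis t)) ^ 2 / (2 * pi))"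
proof -
  define c where "c = fps_nth (fps_expansion g 0)"
  define P where "P = (\<lambda>t. \<Sum>k<n. c k * cis t ^ k)"
  have cont: "continuous_on (cball 0 1) g"
    by (rule continuous_on_subset[OF holomorphic_on_imp_continuous_on[OF hol]]) (use \<rho> in auto)
  have "continuous_on {0..2*pi} (\<lambda>t. g (cis t))"
    by (rule continuous_on_compose2[OF cont]) (auto intro!: continuous_intros)
  then have "(\<lambda>t. cmod (g (cis t)) ^ 2) integrable_on {0..2*pi}"
    by (intro integrable_continuous_real continuous_intros)
  then have i1: "((\<lambda>t. cmod (g (cis t)) ^ 2) has_integral integral {0..2*pi} (\<lambda>t. cmod (g (cis t)) ^ 2)) {0..2*pi}"
    by (rule integrable_integral)
  have S: "Re (\<Sum>k<n. c k * cnj (c k)) = (\<Sum>k<n. cmod (c k) ^ 2)"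
    by (simp only: Re_sum Re_mult_cnj_self)
  have "((\<lambda>t. 2 * Re (g (cis t) * cnj (P t)) - cmod (P t) ^ 2) has_integral
      2 * (2 * pi * (\<Sum>k<n. cmod (c k) ^ 2)) - 2 * pi * (\<Sum>k<n. cmod (c k) ^ 2)) {0..2*pi}"
    using inner_product_polynomial[OF hol \<rho>, where n = n and c = c] parseval_polynomial[where n = n and c = c]
    unfolding P_def c_def[symmetric] S by (intro has_integral_diff has_integral_mult_right)
  then have "2 * (2 * pi * (\<Sum>k<n. cmod (c k) ^ 2)) - 2 * pi * (\<Sum>k<n. cmod (c k) ^ 2)
      \<le> integral {0..2*pi} (\<lambda>t. cmod (g (cis t)) ^ 2)"
  proof (rule has_integral_le[OF _ i1])
    fix t
    have "0 \<le> cmod (g (cis t) - P t) ^ 2" by simp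
    also have "\<dots> = cmod (g (cis t)) ^ 2 - 2 * Re (g (cis t) * cnj (P t)) + cmod (P t) ^ 2"
      unfolding cmod_power2 by (simp add: power2_eq_square algebra_simps)
    finally show "2 * Re (g (cis t) * cnj (P t)) - cmod (P t) ^ 2 \<le> cmod (g (cis t)) ^ 2" by simp
  qed
  then show ?thesis
    by (simp add: c_def field_simps)
qed

section \<open>Factorization into an inner function and a cube\<close>

lemma divide_out_zero:
  assumes hol: "F holomorphic_on S" and S: "open S" "connected S"
    and a: "a \<in> S" and nonconst: "\<not> F constant_on S"
  obtains n F1 where "F1 holomorphic_on S" "F1 a \<noteq> 0" "\<And>z. z \<in> S \<Longrightarrow> F z = (z - a) ^ n * F1 z"
proof (cases "F a = 0")
  case False
  show thesis
    by (rule that[of F 0]) (use hol False in auto)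
next
  case True
  obtain g and r :: real and n :: nat where n: "0 < n" "0 < r" "ball a r \<subseteq> S" "g holomorphic_on ball a r"
      "\<And>w. w \<in> ball a r \<Longrightarrow> F w = (w - a) ^ n * g w" "\<And>w. w \<in> ball a r \<Longrightarrow> g w \<noteq> 0"
    by (rule holomorphic_factor_zero_nonconstant[OF hol S a True nonconst]) (rule that)
  define F1 where "F1 = (\<lambda>z. if z \<in> ball a r then g z else F z / (z - a) ^ n)"
  have "F1 holomorphic_on ball a r \<union> (S - {a})"
    unfolding F1_def
  proof (rule holomorphic_on_If_Un)
    show "(\<lambda>z. F z / (z - a) ^ n) holomorphic_on S - {a}"
      by (intro holomorphic_intros holomorphic_on_subset[OF hol]) auto
  qed (use n S in \<open>auto simp: open_delete\<close>)
  moreover have "ball a r \<union> (S - {a}) = S" using n a by auto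
  ultimately have "F1 holomorphic_on S" by simp
  moreover have "F1 a \<noteq> 0" using n by (simp add: F1_def)
  moreover have "F z = (z - a) ^ n * F1 z" if "z \<in> S" for z
    using n that by (auto simp: F1_def)
  ultimately show thesis by (rule that)
qed

lemma blaschke_factor_norm:
  assumes "cmod z = 1"
  shows "cmod (z - a) = cmod (1 - cnj a * z)"
proof -
  have "1 - cnj a * z = z * cnj (z - a)"
    using assms by (simp add: algebra_simps complex_norm_square[symmetric])
  then show ?thesis
    using assms by (simp add: norm_mult del: complex_cnj_diff)
qed

text \<open>
  The zeros in the disc are removed one point at a time, by induction on their number: at a zero \<open>a\<close>
  of order \<open>n\<close>, the factor \<open>(z - a)\<^sup>n\<close> is replaced by the \<open>n\<close>-th power of the Blaschke
  factor of \<open>a\<close>, and the denominators \<open>(1 - a\<^sup>* z)\<^sup>n\<close>, with \<open>a\<^sup>*\<close> the conjugate of \<open>a\<close>, are moved into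
  the zero-free part \<open>H\<close>.
\<close>

lemma blaschke_factorization:
  assumes "F holomorphic_on ball 0 R" "R > 1" "\<And>z. cmod z = 1 \<Longrightarrow> F z \<noteq> 0"
  shows "\<exists>\<rho> B H. \<rho> > 1 \<and> \<rho> \<le> R \<and> B holomorphic_on ball 0 \<rho> \<and> (\<forall>z. cmod z = 1 \<longrightarrow> cmod (B z) = 1) \<and>
      H holomorphic_on ball 0 \<rho> \<and> (\<forall>z\<in>cball 0 1. H z \<noteq> 0) \<and> (\<forall>z\<in>ball 0 \<rho>. F z = B z * H z)"
  using assms
proof (induction "card {z \<in> cball 0 1. F z = 0}" arbitrary: F rule: less_induct)
  case less
  note hol = less.prems(1) and R = less.prems(2) and nz = less.prems(3)
  have one: "(1::complex) \<in> ball 0 R" using R by simp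
  have sub: "cball 0 1 \<subseteq> ball (0::complex) R" using R by auto
  show ?case
  proof (cases "\<exists>a\<in>cball 0 1. F a = 0")
    case False
    show ?thesis
      by (rule exI[of _ R], rule exI[of _ "\<lambda>_. 1"], rule exI[of _ F])
         (use False R hol in \<open>auto intro: holomorphic_intros\<close>)
  next
    case True
    then obtain a where a: "a \<in> cball 0 1" "F a = 0" by blast
    have a1: "cmod a < 1"
      using a nz[of a] by (cases "cmod a = 1") auto
    have nonconst: "\<not> F constant_on ball 0 R"
      using a nz[of 1] one sub unfolding constant_on_def by (metis norm_one subsetD)
    have aR: "a \<in> ball 0 R" using a sub by blast
    obtain n F1 where F1: "F1 holomorphic_on ball 0 R" "F1 a \<noteq> 0"
        "\<And>z. z \<in> ball 0 R \<Longrightarrow> F z = (z - a) ^ n * F1 z"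
      using divide_out_zero[OF hol open_ball connected_ball aR nonconst] by blast
    have fin: "finite {z \<in> cball 0 1. F z = 0}"
      by (rule holomorphic_compact_finite_zeros[OF hol _ _ _ sub nonconst]) auto
    have "{z \<in> cball 0 1. F1 z = 0} \<subset> {z \<in> cball 0 1. F z = 0}"
      using F1 a sub by (auto simp: subset_iff)
    then have "card {z \<in> cball 0 1. F1 z = 0} < card {z \<in> cball 0 1. F z = 0}"
      using fin by (rule psubset_card_mono[rotated])
    moreover have "F1 z \<noteq> 0" if "cmod z = 1" for z
      using F1(3)[of z] nz[OF that] that R by auto
    ultimately obtain \<rho> B H where IH: "\<rho> > 1" "\<rho> \<le> R" "B holomorphic_on ball 0 \<rho>"
        "\<And>z. cmod z = 1 \<Longrightarrow> cmod (B z) = 1" "H holomorphic_on ball 0 \<rho>"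
        "\<And>z. z \<in> cball 0 1 \<Longrightarrow> H z \<noteq> 0" "\<And>z. z \<in> ball 0 \<rho> \<Longrightarrow> F1 z = B z * H z"
      using less.hyps[OF _ F1(1) R] by blast
    \<comment> \<open>The Blaschke factor has its pole at modulus \<open>1/|a|\<close>; the radius \<open>2/(1 + |a|)\<close> lies strictly between
      \<open>1\<close> and \<open>1/|a|\<close>, and it is meaningful for \<open>a = 0\<close> too.\<close>
    define \<sigma> where "\<sigma> = min \<rho> (2 / (1 + cmod a))"
    have \<sigma>: "1 < \<sigma>" "\<sigma> \<le> \<rho>"
      using IH(1) a1 by (auto simp: \<sigma>_def field_simps add_pos_nonneg)
    have pole: "1 - cnj a * z \<noteq> 0" if "z \<in> ball 0 \<sigma>" for z
    proof -
      have "cmod z < 2 / (1 + cmod a)" using that by (simp add: \<sigma>_def)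
      then have "cmod z * (1 + cmod a) < 2"
        by (simp add: field_simps add_pos_nonneg)
      then have "cmod (cnj a * z) < 1"
      proof (cases "cmod z \<le> 1")
        case True
        then have "cmod a * cmod z \<le> cmod a * 1"
          by (intro mult_left_mono) auto
        then show ?thesis using a1 by (simp add: norm_mult)
      next
        case False
        then show ?thesis using \<open>cmod z * (1 + cmod a) < 2\<close>
          by (simp add: norm_mult algebra_simps)
      qed
      then show ?thesis by auto
    qed
    have sub': "ball 0 \<sigma> \<subseteq> ball (0::complex) \<rho>" using \<sigma> by auto
    define B' where "B' = (\<lambda>z. ((z - a) / (1 - cnj a * z)) ^ n * B z)"
    define H' where "H' = (\<lambda>z. (1 - cnj a * z) ^ n * H z)"
    show ?thesis
    proof (rule exI[of _ \<sigma>], rule exI[of _ B'], rule exI[of _ H'], intro conjI allI impI ballI)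
      show "1 < \<sigma>" "\<sigma> \<le> R"
        using \<sigma> IH(2) by auto
      show "B' holomorphic_on ball 0 \<sigma>"
        unfolding B'_def by (intro holomorphic_intros holomorphic_on_subset[OF IH(3) sub'] pole)
      show "H' holomorphic_on ball 0 \<sigma>"
        unfolding H'_def by (intro holomorphic_intros holomorphic_on_subset[OF IH(5) sub'])
      show "cmod (B' z) = 1" if "cmod z = 1" for z
      proof -
        have "1 - cnj a * z \<noteq> 0" using pole[of z] that \<sigma> by simp
        then show ?thesis
          using blaschke_factor_norm[OF that, of a] IH(4)[OF that]
          by (simp add: B'_def norm_mult norm_power norm_divide)
      qed
      show "H' z \<noteq> 0" if "z \<in> cball 0 1" for z
        using IH(6)[OF that] pole[of z] that \<sigma> by (auto simp: H'_def)
      show "F z = B' z * H' z" if "z \<in> ball 0 \<sigma>" for z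
      proof -
        have "z \<in> ball 0 \<rho>" "z \<in> ball 0 R" using that \<sigma> IH(2) by auto
        then show ?thesis
          using F1(3) IH(7) pole[OF that] by (simp add: B'_def H'_def power_divide)
      qed
    qed
  qed
qed

text \<open>
  The zero-free part has no zeros in a slightly larger disc either, by compactness, and a zero-free
  holomorphic function on a disc has a logarithm, hence a cube root.
\<close>

lemma inner_times_cube:
  assumes "F holomorphic_on ball 0 R" "R > 1" "\<And>z. cmod z = 1 \<Longrightarrow> F z \<noteq> 0"
  obtains \<rho> B g where "\<rho> > 1" "B holomorphic_on ball 0 \<rho>" "g holomorphic_on ball 0 \<rho>"
    "\<And>z. cmod z = 1 \<Longrightarrow> cmod (B z) = 1" "\<And>z. z \<in> ball 0 \<rho> \<Longrightarrow> F z = B z * g z ^ 3"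
proof -
  obtain \<rho> B H where *: "\<rho> > 1" "B holomorphic_on ball 0 \<rho>"
        "\<And>z. cmod z = 1 \<Longrightarrow> cmod (B z) = 1" "H holomorphic_on ball 0 \<rho>"
        "\<And>z. z \<in> cball 0 1 \<Longrightarrow> H z \<noteq> 0" "\<And>z. z \<in> ball 0 \<rho> \<Longrightarrow> F z = B z * H z"
    using blaschke_factorization[OF assms] by blast
  define U where "U = {z \<in> ball 0 \<rho>. H z \<in> - {0}}"
  have "open U"
    unfolding U_def
    by (rule continuous_open_preimage[of "ball 0 \<rho>" H "- {0}", unfolded vimage_def Int_def mem_Collect_eq])
       (use *(4) in \<open>auto intro: holomorphic_on_imp_continuous_on\<close>)
  moreover have "cball 0 1 \<subseteq> U" using * by (auto simp: U_def)
  ultimately obtain \<epsilon> where \<epsilon>: "\<epsilon> > 0" "(\<Union>x\<in>cball 0 1. ball x \<epsilon>) \<subseteq> U"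
    using compact_subset_open_imp_ball_epsilon_subset[of "cball 0 1" U] by auto
  have sub: "ball 0 (1 + \<epsilon>) \<subseteq> U"
  proof
    fix z :: complex assume z: "z \<in> ball 0 (1 + \<epsilon>)"
    show "z \<in> U"
    proof (cases "cmod z \<le> 1")
      case True
      then show ?thesis using \<open>cball 0 1 \<subseteq> U\<close> by auto
    next
      case False
      have "dist (z /\<^sub>R cmod z) z = cmod z - 1"
      proof -
        have "z - z /\<^sub>R cmod z = (1 - 1 / cmod z) *\<^sub>R z"
          by (simp add: algebra_simps divide_inverse)
        then have "dist (z /\<^sub>R cmod z) z = \<bar>1 - 1 / cmod z\<bar> * cmod z"
          by (metis dist_norm norm_minus_commute norm_scaleR)
        also have "\<bar>1 - 1 / cmod z\<bar> = 1 - 1 / cmod z"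
          using False by (intro abs_of_nonneg) (simp add: divide_le_eq)
        also have "(1 - 1 / cmod z) * cmod z = cmod z - 1" using False by (auto simp: field_simps)
        finally show ?thesis .
      qed
      then have "z \<in> ball (z /\<^sub>R cmod z) \<epsilon>" using z by simp
      moreover have "z /\<^sub>R cmod z \<in> cball 0 1" by (cases "z = 0") auto
      ultimately show ?thesis using \<epsilon>(2) by blast
    qed
  qed
  have sub2: "ball 0 (1 + \<epsilon>) \<subseteq> ball (0::complex) \<rho>"
    using sub by (auto simp: U_def)
  have nzH: "H z \<noteq> 0" if "z \<in> ball 0 (1 + \<epsilon>)" for z
    using sub that unfolding U_def by blast
  obtain l where l: "l holomorphic_on ball 0 (1 + \<epsilon>)" "\<And>z. z \<in> ball 0 (1 + \<epsilon>) \<Longrightarrow> exp (l z) = H z"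
  proof (rule holomorphic_logarithm_exists[of "ball 0 (1 + \<epsilon>)" H 0])
    show "H holomorphic_on ball 0 (1 + \<epsilon>)" by (rule holomorphic_on_subset[OF *(4) sub2])
  qed (use \<epsilon> nzH in auto)
  show thesis
  proof (rule that[of "1 + \<epsilon>" B "\<lambda>z. exp (l z / 3)"])
    show "F z = B z * exp (l z / 3) ^ 3" if "z \<in> ball 0 (1 + \<epsilon>)" for z
    proof -
      have "exp (l z / 3) ^ 3 = exp (l z)"
        using exp_of_nat_mult[of 3 "l z / 3"] by simp
      then show ?thesis using *(6) l(2)[OF that] sub2 that by auto
    qed
    show "B holomorphic_on ball 0 (1 + \<epsilon>)"
      by (rule holomorphic_on_subset[OF *(2) sub2])
    show "(\<lambda>z. exp (l z / 3)) holomorphic_on ball 0 (1 + \<epsilon>)"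
      by (intro holomorphic_intros l(1)) auto
  qed (use \<epsilon> *(3) in auto)
qed

lemma cube_powr_two_thirds:
  fixes x :: real
  assumes "x \<ge> 0"
  shows "(x ^ 3) powr (2/3) = x ^ 2"
proof (cases "x = 0")
  case False
  then have "(x ^ 3) powr (2/3) = (x powr 3) powr (2/3)"
    using assms by simp
  also have "\<dots> = x powr 2"
    unfolding powr_powr by simp
  finally show ?thesis
    using False assms by simp
qed simp

text \<open>
  For the dilation \<open>F(z) = f(r z) = B g\<^sup>3\<close>, the series \<open>U\<close> and \<open>V\<close> are those of \<open>B g\<close> and \<open>g\<close>. Both have
  modulus \<open>|F|\<^bsup>1/3\<^esup>\<close> on the unit circle, so the mean of their squared moduli is the mean of \<open>|f|\<^bsup>2/3\<^esup>\<close>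
  over the circle of radius \<open>r\<close>, and Bessel's inequality applies.
\<close>

lemma hardy_factorization:
  assumes hol: "f holomorphic_on ball 0 1" and r: "0 < r" "r < 1"
    and nz: "\<And>z. cmod z = r \<Longrightarrow> f z \<noteq> 0"
  obtains U V :: "complex fps" where
    "\<And>n. fps_nth (fps_expansion f 0) n * of_real r ^ n = fps_nth (U * V * V) n"
    "\<And>n. (\<Sum>k<n. cmod (fps_nth U k) ^ 2) \<le> hardy_mean (2/3) f r"
    "\<And>n. (\<Sum>k<n. cmod (fps_nth V k) ^ 2) \<le> hardy_mean (2/3) f r"
proof -
  define F where "F = (\<lambda>z. f (of_real r * z))"
  have hF: "F holomorphic_on ball 0 (1 / r)"
    unfolding F_def
    by (rule holomorphic_on_compose_gen[OF _ hol, unfolded o_def])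
       (use r in \<open>auto intro!: holomorphic_intros simp: norm_mult field_simps\<close>)
  obtain \<rho> B g where *: "\<rho> > 1" "B holomorphic_on ball 0 \<rho>" "g holomorphic_on ball 0 \<rho>"
    "\<And>z. cmod z = 1 \<Longrightarrow> cmod (B z) = 1" "\<And>z. z \<in> ball 0 \<rho> \<Longrightarrow> F z = B z * g z ^ 3"
  proof (rule inner_times_cube[OF hF])
    show "1 < 1 / r" using r by simp
    show "F z \<noteq> 0" if "cmod z = 1" for z
      unfolding F_def by (rule nz) (use that r in \<open>simp add: norm_mult\<close>)
  qed blast
  define U where "U = fps_expansion (\<lambda>z. B z * g z) 0"
  define V where "V = fps_expansion g 0"
  have hBg: "(\<lambda>z. B z * g z) holomorphic_on ball 0 \<rho>"
    by (intro holomorphic_intros *)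
  have "F has_fps_expansion Abs_fps (\<lambda>n. fps_nth (fps_expansion f 0) n * of_real r ^ n)"
  proof (rule sums_imp_has_fps_expansion[of 1])
    fix z :: complex assume "z \<in> ball 0 1"
    then have "r * cmod z \<le> r * 1"
      using r by (intro mult_left_mono) auto
    then have "r * cmod z < 1" using r by linarith
    then have "of_real r * z \<in> ball 0 1"
      using r by (simp add: norm_mult)
    from holomorphic_power_series[OF hol this]
    have "(\<lambda>n. fps_nth (fps_expansion f 0) n * (of_real r * z) ^ n) sums F z"
      by (simp add: F_def fps_expansion_def)
    then show "(\<lambda>n. fps_nth (fps_expansion f 0) n * of_real r ^ n * z ^ n) sums F z"
      by (simp add: power_mult_distrib mult_ac)
  qed simp
  moreover have "F has_fps_expansion U * V * V"
  proof -
    have "(\<lambda>z. B z * g z * g z * g z) has_fps_expansion U * V * V"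
      unfolding U_def V_def
      by (intro has_fps_expansion_mult has_fps_expansion_fps_expansion[of "ball 0 \<rho>"] *(3) hBg) (use * in auto)
    moreover have "eventually (\<lambda>z. B z * g z * g z * g z = F z) (nhds 0)"
      using eventually_nhds_in_open[of "ball 0 \<rho>" 0]
      by (rule eventually_mono) (use * in \<open>auto simp: power3_eq_cube\<close>)
    ultimately show ?thesis
      by (subst (asm) has_fps_expansion_cong[OF _ refl])
  qed
  ultimately have fps: "Abs_fps (\<lambda>n. fps_nth (fps_expansion f 0) n * of_real r ^ n) = U * V * V"
    by (rule fps_expansion_unique_complex)
  have mean: "hardy_mean (2/3) f r = integral {0..2*pi} (\<lambda>t. cmod (g (cis t)) ^ 2 / (2 * pi))"
    unfolding hardy_mean_def
  proof (rule integral_cong)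
    fix t :: real
    have "cmod (f (rcis r t)) = cmod (g (cis t)) ^ 3"
      using *(5)[of "cis t"] *(1) *(4)[of "cis t"] by (simp add: F_def rcis_def norm_mult norm_power)
    then show "cmod (f (rcis r t)) powr (2/3) / (2*pi) = cmod (g (cis t)) ^ 2 / (2*pi)"
      by (simp add: cube_powr_two_thirds)
  qed
  show thesis
  proof (rule that[of U V])
    show "fps_nth (fps_expansion f 0) n * of_real r ^ n = fps_nth (U * V * V) n" for n
      using fps by (metis fps_nth_Abs_fps)
    show "(\<Sum>k<n. cmod (fps_nth V k) ^ 2) \<le> hardy_mean (2/3) f r" for n
      unfolding mean V_def by (rule bessel_inequality) (use * in auto)
    have "integral {0..2*pi} (\<lambda>t. cmod (B (cis t) * g (cis t)) ^ 2 / (2 * pi)) = hardy_mean (2/3) f r"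
      unfolding mean by (rule integral_cong) (simp add: norm_mult *(4))
    then show "(\<Sum>k<n. cmod (fps_nth U k) ^ 2) \<le> hardy_mean (2/3) f r" for n
      using bessel_inequality[OF hBg *(1), of n] unfolding U_def by simp
  qed
qed

section \<open>The sharp bound\<close>

lemma fps_nth_mult_cubic: "fps_nth (U * V * V) 3 = cubic_coeff (fps_nth U) (fps_nth V)"
  by (simp add: fps_mult_nth eval_nat_numeral cubic_coeff_def algebra_simps)

lemma bounded_family_subsequence:
  fixes x :: "nat \<Rightarrow> nat \<Rightarrow> complex"
  assumes "\<And>j k. cmod (x j k) \<le> C"
  obtains s l where "strict_mono (s :: nat \<Rightarrow> nat)" "\<And>k. k < n \<Longrightarrow> (\<lambda>j. x (s j) k) \<longlonglongrightarrow> l k"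
proof -
  have "\<exists>s l. strict_mono (s :: nat \<Rightarrow> nat) \<and> (\<forall>k<n. (\<lambda>j. x (s j) k) \<longlonglongrightarrow> l k)"
  proof (induction n)
    case 0
    show ?case by (rule exI[of _ id]) (simp add: strict_mono_def)
  next
    case (Suc n)
    then obtain s l where s: "strict_mono (s :: nat \<Rightarrow> nat)" "\<And>k. k < n \<Longrightarrow> (\<lambda>j. x (s j) k) \<longlonglongrightarrow> l k" by blast
    have "bounded (range (\<lambda>j. x (s j) n))"
      by (rule boundedI[of _ C]) (use assms in auto)
    then obtain y t where t: "strict_mono (t :: nat \<Rightarrow> nat)" "((\<lambda>j. x (s j) n) \<circ> t) \<longlonglongrightarrow> y"
      using bounded_imp_convergent_subsequence by metis
    have "(\<lambda>j. x ((s \<circ> t) j) k) \<longlonglongrightarrow> (l(n := y)) k" if "k < Suc n" for k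
    proof (cases "k = n")
      case True
      then show ?thesis using t by (simp add: o_def)
    next
      case False
      then show ?thesis
        using LIMSEQ_subseq_LIMSEQ[OF s(2) t(1), of k] that by (simp add: o_def)
    qed
    then show ?case
      using strict_mono_o[OF s(1) t(1)] by blast
  qed
  then show thesis using that by blast
qed

text \<open>
  Each closed disc of radius less than \<open>1\<close> contains only finitely many zeros, so the open interval
  between \<open>1 - 1/(j + 2)\<close> and \<open>1 - 1/(j + 3)\<close> contains a radius that is not the modulus of a zero.
\<close>

lemma radii_avoiding_zeros:
  assumes hol: "f holomorphic_on ball 0 1" and nz: "z0 \<in> ball 0 1" "f z0 \<noteq> 0"
  obtains r where "\<And>j::nat. 0 < r j \<and> r j < 1" "\<And>j z. cmod z = r j \<Longrightarrow> f z \<noteq> 0" "r \<longlonglongrightarrow> 1"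
proof -
  define K where "K = (\<lambda>j::nat. cball (0::complex) (1 - 1 / real (j + 3)))"
  have KB: "K j \<subseteq> ball 0 1" for j
    unfolding K_def cball_subset_ball_iff by simp
  have fin: "finite {z \<in> K j. f z = 0}" for j
  proof (cases "f constant_on ball 0 1")
    case True
    have "{z \<in> K j. f z = 0} = {}" using True nz KB[of j] by (auto simp: constant_on_def)
    then show ?thesis by (simp only: finite.emptyI)
  next
    case False
    then show ?thesis
      by (intro holomorphic_compact_finite_zeros[OF hol _ _ _ KB]) (auto simp: K_def)
  qed
  have "\<exists>r. 1 - 1 / real (j + 2) < r \<and> r < 1 - 1 / real (j + 3) \<and> r \<notin> cmod ` {z \<in> K j. f z = 0}" for j
  proof -
    have "infinite {1 - 1 / real (j + 2) <..< 1 - 1 / real (j + 3)}"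
      by (intro infinite_Ioo) (simp add: field_simps)
    then have "infinite ({1 - 1 / real (j + 2) <..< 1 - 1 / real (j + 3)} - cmod ` {z \<in> K j. f z = 0})"
      using fin by (intro Diff_infinite_finite finite_imageI)
    then have "{1 - 1 / real (j + 2) <..< 1 - 1 / real (j + 3)} - cmod ` {z \<in> K j. f z = 0} \<noteq> {}"
      by (metis finite.emptyI)
    then show ?thesis by auto
  qed
  then obtain r where r: "\<And>j. 1 - 1 / real (j + 2) < r j" "\<And>j. r j < 1 - 1 / real (j + 3)"
      "\<And>j. r j \<notin> cmod ` {z \<in> K j. f z = 0}"
    by metis
  have r1: "r j < 1" for j
    by (rule less_le_trans[OF r(2)]) simp
  have "r \<longlonglongrightarrow> 1"
  proof (rule tendsto_sandwich)
    show "(\<lambda>j. 1 - 1 / real (j + 2)) \<longlonglongrightarrow> 1" "(\<lambda>j. 1 - 1 / real (j + 3)) \<longlonglongrightarrow> 1"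
      by real_asymp+
  qed (use r r1 in \<open>auto intro!: always_eventually less_imp_le\<close>)
  moreover have "0 < r j" for j
    using r(1)[of j] by (rule le_less_trans[rotated]) simp
  moreover have "f z \<noteq> 0" if "cmod z = r j" for z j
  proof
    assume "f z = 0"
    then have "z \<in> {z \<in> K j. f z = 0}"
      using r(2)[of j] that by (simp add: K_def)
    then have "r j \<in> cmod ` {z \<in> K j. f z = 0}"
      unfolding that[symmetric] by (rule imageI)
    then show False using r(3) by blast
  qed
  ultimately show thesis using r1 by (intro that) auto
qed

lemma hardy_mean_sequence:
  assumes f: "f \<in> hardy_space p" and r: "\<And>j. r j < 1" "r \<longlonglongrightarrow> 1"
  shows "(\<lambda>j. hardy_mean p f (r j)) \<longlonglongrightarrow> Lim (at_left 1) (hardy_mean p f)"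
proof -
  obtain L where L: "(hardy_mean p f \<longlongrightarrow> L) (at_left 1)"
    using f by (auto simp: hardy_space_def)
  then have "Lim (at_left 1) (hardy_mean p f) = L"
    by (intro tendsto_Lim) auto
  moreover have "filterlim r (at_left 1) sequentially"
    using r by (auto simp: filterlim_at intro!: always_eventually less_imp_neq)
  ultimately show ?thesis
    using filterlim_compose[OF L] by simp
qed

lemma factorized_sequence:
  assumes f: "f \<in> hardy_space (2/3)" and nz: "z0 \<in> ball 0 1" "f z0 \<noteq> 0"
  obtains r :: "nat \<Rightarrow> real" and U V :: "nat \<Rightarrow> complex fps" and \<mu> :: "nat \<Rightarrow> real" where
    "r \<longlonglongrightarrow> 1" "\<mu> \<longlonglongrightarrow> Lim (at_left 1) (hardy_mean (2/3) f)"
    "\<And>j n. fps_nth (fps_expansion f 0) n * of_real (r j) ^ n = fps_nth (U j * V j * V j) n"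
    "\<And>j n. (\<Sum>k<n. cmod (fps_nth (U j) k) ^ 2) \<le> \<mu> j"
    "\<And>j n. (\<Sum>k<n. cmod (fps_nth (V j) k) ^ 2) \<le> \<mu> j"
proof -
  have hol: "f holomorphic_on ball 0 1" using f by (simp add: hardy_space_def)
  obtain r where r: "\<And>j::nat. 0 < r j \<and> r j < 1" "\<And>j z. cmod z = r j \<Longrightarrow> f z \<noteq> 0" "r \<longlonglongrightarrow> 1"
    by (rule radii_avoiding_zeros[OF hol nz]) (rule that)
  define good where "good = (\<lambda>j U V. (\<forall>n. fps_nth (fps_expansion f 0) n * of_real (r j) ^ n = fps_nth (U * V * V) n) \<and>
    (\<forall>n. (\<Sum>k<n. cmod (fps_nth U k) ^ 2) \<le> hardy_mean (2/3) f (r j)) \<and>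
    (\<forall>n. (\<Sum>k<n. cmod (fps_nth V k) ^ 2) \<le> hardy_mean (2/3) f (r j)))"
  have "\<exists>U V. good j U V" for j
  proof -
    obtain U V where "good j U V"
      by (rule hardy_factorization[of f "r j", OF hol conjunct1[OF r(1)] conjunct2[OF r(1)] r(2)])
         (auto simp: good_def intro: that)
    then show ?thesis by blast
  qed
  then obtain U V where "\<And>j. good j (U j) (V j)" by metis
  then have "\<And>j n. fps_nth (fps_expansion f 0) n * of_real (r j) ^ n = fps_nth (U j * V j * V j) n"
    "\<And>j n. (\<Sum>k<n. cmod (fps_nth (U j) k) ^ 2) \<le> hardy_mean (2/3) f (r j)"
    "\<And>j n. (\<Sum>k<n. cmod (fps_nth (V j) k) ^ 2) \<le> hardy_mean (2/3) f (r j)"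
    by (simp_all add: good_def)
  then show thesis
    using hardy_mean_sequence[OF f, of r] r by (intro that[of r "\<lambda>j. hardy_mean (2/3) f (r j)" U V]) auto
qed

lemma fps_expansion_zero:
  assumes "\<And>z. z \<in> ball 0 1 \<Longrightarrow> f z = 0"
  shows "fps_expansion f 0 = 0"
proof -
  have "f has_fps_expansion Abs_fps (\<lambda>_. 0)"
    by (rule sums_imp_has_fps_expansion[of 1]) (use assms in auto)
  then show ?thesis by (simp add: fps_expansion_eqI fps_eq_iff)
qed

text \<open>
  On the circle of radius \<open>r\<^sub>j\<close> the trilinear estimate bounds \<open>|a\<^sub>3| r\<^sub>j\<^sup>3\<close> by \<open>max_coeff\<close> times \<open>\<mu>\<^sub>j\<^bsup>3/2\<^esup>\<close>,
  where \<open>\<mu>\<^sub>j\<close> is the mean of \<open>|f|\<^bsup>2/3\<^esup>\<close>; then \<open>j\<close> tends to infinity.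
\<close>

theorem third_coefficient_bound:
  assumes f: "f \<in> hardy_space (2/3)"
  shows "cmod (fps_nth (fps_expansion f 0) 3) \<le> max_coeff * hardy_norm (2/3) f"
proof (cases "\<exists>z0\<in>ball 0 1. f z0 \<noteq> 0")
  case False
  then show ?thesis
    using fps_expansion_zero[of f] max_coeff_pos by (auto simp: hardy_norm_def)
next
  case True
  then obtain z0 where nz: "z0 \<in> ball 0 1" "f z0 \<noteq> 0" by blast
  define L where "L = Lim (at_left 1) (hardy_mean (2/3) f)"
  obtain r U V \<mu> where *: "r \<longlonglongrightarrow> 1" "\<mu> \<longlonglongrightarrow> L"
    "\<And>j n. fps_nth (fps_expansion f 0) n * of_real (r j) ^ n = fps_nth (U j * V j * V j) n"
    "\<And>j n. (\<Sum>k<n. cmod (fps_nth (U j) k) ^ 2) \<le> \<mu> j"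
    "\<And>j n. (\<Sum>k<n. cmod (fps_nth (V j) k) ^ 2) \<le> \<mu> j"
    by (rule factorized_sequence[OF f nz, folded L_def]) (rule that)
  have \<mu>: "0 \<le> \<mu> j" for j using *(4)[where n = 0 and j = j] by simp
  then have L: "0 \<le> L" using *(2) by (intro LIMSEQ_le_const) auto
  have "cmod (fps_nth (fps_expansion f 0) 3 * of_real (r j) ^ 3) \<le> max_coeff * sqrt (\<mu> j) * \<mu> j" for j
  proof -
    have "cmod (cubic_coeff (fps_nth (U j)) (fps_nth (V j))) \<le>
      max_coeff * sqrt (\<Sum>k<4. cmod (fps_nth (U j) k) ^ 2) * (\<Sum>k<4. cmod (fps_nth (V j) k) ^ 2)"
      by (rule cubic_coeff_bound)
    also have "\<dots> \<le> max_coeff * sqrt (\<mu> j) * \<mu> j"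
      using *(4,5)[where n = 4 and j = j] max_coeff_pos \<mu> by (intro mult_mono) (auto simp: sum_nonneg)
    finally show ?thesis unfolding *(3) fps_nth_mult_cubic .
  qed
  moreover have "(\<lambda>j. cmod (fps_nth (fps_expansion f 0) 3 * of_real (r j) ^ 3)) \<longlonglongrightarrow>
      cmod (fps_nth (fps_expansion f 0) 3 * of_real 1 ^ 3)"
    by (intro tendsto_intros *)
  moreover have "(\<lambda>j. max_coeff * sqrt (\<mu> j) * \<mu> j) \<longlonglongrightarrow> max_coeff * sqrt L * L"
    by (intro tendsto_intros *)
  ultimately have "cmod (fps_nth (fps_expansion f 0) 3 * of_real 1 ^ 3) \<le> max_coeff * sqrt L * L"
    by (intro LIMSEQ_le) auto
  also have "sqrt L * L = L powr (3/2)"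
  proof (cases "L = 0")
    case False
    then have "L powr (3/2) = L powr (1/2) * L powr 1"
      by (subst powr_add[symmetric]) simp
    then show ?thesis using L False by (simp add: powr_half_sqrt)
  qed simp
  then have "max_coeff * sqrt L * L = max_coeff * hardy_norm (2/3) f"
    by (simp add: hardy_norm_def L_def mult.assoc)
  finally show ?thesis by simp
qed


section \<open>The rotated extremal functions\<close>

lemma extremal_coeff_cubic:
  "cubic_coeff (\<lambda>k. of_real (extremal_coeff k)) (\<lambda>k. of_real (extremal_coeff k)) = of_real max_coeff"
  unfolding extremal_coeff_cubic_real[symmetric] by (simp add: cubic_coeff_def)

lemma extremal_fun_eq_cube: "extremal_fun z = (\<Sum>k<4. of_real (extremal_coeff k) * z ^ k) ^ 3"
proof -
  define m where "m = (483 - 19 * sqrt 33) / 1153"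
  have m: "m > 0" unfolding m_def using sqrt33 by simp
  have "m powr (3/2) = sqrt m ^ 3"
    using m by (simp add: powr_half_sqrt[symmetric] powr_power)
  then have "of_real (m powr (3/2)) = (of_real (sqrt m) :: complex) ^ 3"
    by simp
  then show ?thesis
    unfolding extremal_fun_def m_def[symmetric] power_mult_distrib[symmetric]
    by (simp add: extremal_coeff_def m_def[symmetric] sum_lessThan_4 power_mult_distrib[symmetric] algebra_simps)
qed

text \<open>
  These are the coefficient sequences found in \<open>cubic_coeff_equality\<close>, with \<open>c\<close> for the constant phase,
  extended by \<open>0\<close>. The extension matters, since the list defining \<open>extremal_coeff\<close> has four entries.
\<close>

definition rotated_coeff :: "complex \<Rightarrow> real \<Rightarrow> nat \<Rightarrow> complex" where
  "rotated_coeff c \<theta> k = (if k < 4 then c * cis (k * \<theta>) * of_real (extremal_coeff k) else 0)"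

definition rotated_extremal :: "real \<Rightarrow> complex \<Rightarrow> complex" where
  "rotated_extremal \<theta> z = cis (- 3 * \<theta>) * extremal_fun (cis \<theta> * z)"

lemma rotated_coeff_polynomial:
  "(\<Sum>k<4. rotated_coeff c \<theta> k * z ^ k) = c * (\<Sum>k<4. of_real (extremal_coeff k) * (cis \<theta> * z) ^ k)"
  unfolding sum_distrib_left
  by (intro sum.cong) (simp_all add: rotated_coeff_def Complex.DeMoivre power_mult_distrib mult_ac)

text \<open>
  The product of a polynomial with phase \<open>c\<close> and the square of one with phase \<open>d\<close> depends only on
  \<open>c d\<^sup>2\<close>. This freedom absorbs the parameter \<open>\<phi>\<close> of \<open>cubic_coeff_equality\<close>.
\<close>

lemma rotated_extremal_fps:
  assumes c: "c * d ^ 2 = cis (- 3 * \<theta>)"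
  shows "fps_expansion (rotated_extremal \<theta>) 0 =
    Abs_fps (rotated_coeff c \<theta>) * Abs_fps (rotated_coeff d \<theta>) * Abs_fps (rotated_coeff d \<theta>)"
proof -
  define P where "P = (\<lambda>c z. \<Sum>k<4. rotated_coeff c \<theta> k * z ^ k)"
  have P: "P c has_fps_expansion Abs_fps (rotated_coeff c \<theta>)" for c
  proof -
    have "(\<lambda>k. if k < 4 then rotated_coeff c \<theta> k else 0) = rotated_coeff c \<theta>"
      by (auto simp: rotated_coeff_def)
    moreover have "P c has_fps_expansion fps_expansion (P c) 0"
      by (rule has_fps_expansion_fps_expansion[of UNIV]) (auto simp: P_def intro!: holomorphic_intros)
    ultimately show ?thesis
      unfolding P_def fps_expansion_polynomial by simp
  qed
  have "(\<lambda>z. P c z * P d z * P d z) has_fps_expansion Abs_fps (rotated_coeff c \<theta>) * Abs_fps (rotated_coeff d \<theta>) * Abs_fps (rotated_coeff d \<theta>)"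
    by (intro has_fps_expansion_mult P)
  moreover have "(\<lambda>z. P c z * P d z * P d z) = rotated_extremal \<theta>"
  proof
    fix z
    define S where "S = (\<Sum>k<4. of_real (extremal_coeff k) * (cis \<theta> * z) ^ k)"
    have "P c z * P d z * P d z = (c * d ^ 2) * S ^ 3"
      unfolding P_def rotated_coeff_polynomial S_def[symmetric] by (simp add: power2_eq_square power3_eq_cube)
    then show "P c z * P d z * P d z = rotated_extremal \<theta> z"
      unfolding c rotated_extremal_def extremal_fun_eq_cube S_def .
  qed
  ultimately show ?thesis
    by (simp add: fps_expansion_eqI)
qed

lemma rotated_extremal_holomorphic: "rotated_extremal \<theta> holomorphic_on A"
  unfolding rotated_extremal_def extremal_fun_def by (intro holomorphic_intros)

lemma rotated_extremal_third_coefficient: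
  "fps_nth (fps_expansion (rotated_extremal \<theta>) 0) 3 = of_real max_coeff"
proof -
  define w where "w = cis \<theta>"
  have pw: "cis (real k * \<theta>) = w ^ k" for k
    by (simp add: w_def Complex.DeMoivre)
  have "fps_nth (fps_expansion (rotated_extremal \<theta>) 0) 3
      = cubic_coeff (rotated_coeff (cis (- 3 * \<theta>)) \<theta>) (rotated_coeff 1 \<theta>)"
    by (subst rotated_extremal_fps[of "cis (- 3 * \<theta>)" 1]) (simp_all add: fps_nth_mult_cubic Abs_fps_inverse)
  also have "\<dots> = cis (- 3 * \<theta>) * w ^ 3 * cubic_coeff (\<lambda>k. of_real (extremal_coeff k)) (\<lambda>k. of_real (extremal_coeff k))"
    unfolding cubic_coeff_def rotated_coeff_def pw
    by (simp add: power2_eq_square power3_eq_cube algebra_simps)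
  also have "cis (- 3 * \<theta>) * w ^ 3 = 1"
    by (simp add: w_def Complex.DeMoivre cis_mult)
  finally show ?thesis by (simp add: extremal_coeff_cubic)
qed

text \<open>
  The modulus is the cube of that of a polynomial of degree three, so \<open>|g|\<^bsup>2/3\<^esup>\<close> is the square of the
  modulus of that polynomial and the mean is given by Parseval's formula.
\<close>

lemma hardy_mean_rotated_extremal:
  assumes eq: "\<And>z. z \<in> ball 0 1 \<Longrightarrow> g z = rotated_extremal \<theta> z" and r: "0 \<le> r" "r < 1"
  shows "hardy_mean (2/3) g r = (\<Sum>k<4. (extremal_coeff k * r ^ k) ^ 2)"
proof -
  define c where "c = (\<lambda>k. rotated_coeff 1 \<theta> k * of_real r ^ k)"
  have "cmod (g (rcis r t)) powr (2/3) / (2*pi) = cmod (\<Sum>k<4. c k * cis t ^ k) ^ 2 / (2*pi)" for t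
  proof -
    have "(\<Sum>k<4. c k * cis t ^ k) = (\<Sum>k<4. rotated_coeff 1 \<theta> k * rcis r t ^ k)"
      by (simp add: c_def rcis_def power_mult_distrib mult_ac)
    also have "\<dots> = (\<Sum>k<4. of_real (extremal_coeff k) * (cis \<theta> * rcis r t) ^ k)"
      by (simp add: rotated_coeff_polynomial)
    finally have "cmod (g (rcis r t)) = cmod (\<Sum>k<4. c k * cis t ^ k) ^ 3"
      using eq[of "rcis r t"] r by (simp add: rotated_extremal_def extremal_fun_eq_cube norm_mult norm_power)
    then show ?thesis by (simp add: cube_powr_two_thirds)
  qed
  then have "hardy_mean (2/3) g r = integral {0..2*pi} (\<lambda>t. cmod (\<Sum>k<4. c k * cis t ^ k) ^ 2 / (2*pi))"
    by (simp add: hardy_mean_def)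
  also have "\<dots> = 2 * pi * (\<Sum>k<4. cmod (c k) ^ 2) / (2 * pi)"
    by (intro integral_unique has_integral_divide parseval_polynomial)
  also have "\<dots> = (\<Sum>k<4. cmod (c k) ^ 2)" by simp
  also have "\<dots> = (\<Sum>k<4. (extremal_coeff k * r ^ k) ^ 2)"
    using r extremal_coeff_pos by (intro sum.cong) (auto simp: c_def rotated_coeff_def norm_mult norm_power power_mult_distrib)
  finally show ?thesis .
qed

lemma rotated_extremal_properties:
  assumes eq: "\<And>z. z \<in> ball 0 1 \<Longrightarrow> g z = rotated_extremal \<theta> z"
  shows "g \<in> hardy_space (2/3)" "hardy_norm (2/3) g = 1"
    "fps_nth (fps_expansion g 0) 3 = of_real max_coeff"
proof -
  have "((\<lambda>r. \<Sum>k<4. (extremal_coeff k * r ^ k) ^ 2) \<longlongrightarrow> (\<Sum>k<4. (extremal_coeff k * 1 ^ k) ^ 2)) (at_left 1)"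
    by (intro tendsto_intros)
  moreover have "eventually (\<lambda>r. r \<in> {0<..<1}) (at_left (1::real))"
    by (intro eventually_at_left_real) simp
  then have "eventually (\<lambda>r. (\<Sum>k<4. (extremal_coeff k * r ^ k) ^ 2) = hardy_mean (2/3) g r) (at_left 1)"
    by eventually_elim (use hardy_mean_rotated_extremal[OF eq] in auto)
  ultimately have lim: "(hardy_mean (2/3) g \<longlongrightarrow> 1) (at_left 1)"
    using tendsto_cong extremal_coeff_sum by force
  have hol: "g holomorphic_on ball 0 1"
    by (rule holomorphic_transform[OF rotated_extremal_holomorphic]) (simp add: eq)
  show "g \<in> hardy_space (2/3)"
    using lim hol by (auto simp: hardy_space_def)
  have "Lim (at_left 1) (hardy_mean (2/3) g) = 1"
    using lim by (intro tendsto_Lim) auto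
  then show "hardy_norm (2/3) g = 1"
    by (simp add: hardy_norm_def)
  have "eventually (\<lambda>z. z \<in> ball 0 1) (nhds (0::complex))"
    by (intro eventually_nhds_in_open) auto
  then have "eventually (\<lambda>z. g z = rotated_extremal \<theta> z) (nhds 0)"
    by eventually_elim (rule eq)
  then show "fps_nth (fps_expansion g 0) 3 = of_real max_coeff"
    by (simp add: fps_expansion_cong rotated_extremal_third_coefficient)
qed

section \<open>Uniqueness of the extremal function\<close>

lemma holomorphic_eqI_fps_expansion:
  assumes f: "f holomorphic_on ball 0 1" and g: "g holomorphic_on ball 0 1"
    and eq: "fps_expansion f 0 = fps_expansion g 0" and z: "z \<in> ball (0::complex) 1"
  shows "f z = g z"
proof -
  have "(\<lambda>n. fps_nth (fps_expansion f 0) n * z ^ n) sums f z"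
    using holomorphic_power_series[OF f z] by (simp add: fps_expansion_def)
  moreover have "(\<lambda>n. fps_nth (fps_expansion g 0) n * z ^ n) sums g z"
    using holomorphic_power_series[OF g z] by (simp add: fps_expansion_def)
  ultimately show ?thesis
    unfolding eq by (rule sums_unique2)
qed

text \<open>
  The factors \<open>U\<close>, \<open>V\<close> of the dilations have squared coefficient sums bounded by means that tend to \<open>1\<close>.
  A subsequence makes their first four coefficients converge, and the limits \<open>u\<close>, \<open>v\<close> attain
  equality in the trilinear estimate. Hence \<open>u\<close> and \<open>v\<close> are unit vectors, nothing is left
  for the coefficients of index at least four, and these tend to \<open>0\<close>. Passing to the limit in the product
  \<open>U V V\<close> identifies all coefficients of \<open>f\<close>.
\<close>

theorem extremal_unique:
  assumes f: "f \<in> hardy_space (2/3)" and norm: "hardy_norm (2/3) f = 1"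
    and ext: "Re (fps_nth (fps_expansion f 0) 3) = max_coeff"
  obtains \<theta> where "\<And>z. z \<in> ball 0 1 \<Longrightarrow> f z = rotated_extremal \<theta> z"
proof -
  define a where "a = fps_nth (fps_expansion f 0)"
  have hol: "f holomorphic_on ball 0 1" using f by (simp add: hardy_space_def)
  have "cmod (a 3) \<le> Re (a 3)"
    using third_coefficient_bound[OF f] norm ext by (simp add: a_def)
  then have "Re (a 3) = cmod (a 3)" using complex_Re_le_cmod[of "a 3"] by simp
  then have "Im (a 3) = 0" using cmod_power2[of "a 3"] by simp
  then have a3: "a 3 = of_real max_coeff" using ext by (simp add: a_def complex_eq_iff)
  have "\<exists>z0\<in>ball 0 1. f z0 \<noteq> 0"
  proof (rule ccontr)
    assume "\<not> ?thesis"
    then have "fps_expansion f 0 = 0" by (intro fps_expansion_zero) auto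
    then show False using a3 max_coeff_pos by (simp add: a_def)
  qed
  then obtain z0 where nz: "z0 \<in> ball 0 1" "f z0 \<noteq> 0" by blast
  define L where "L = Lim (at_left 1) (hardy_mean (2/3) f)"
  obtain r U V \<mu> where *: "r \<longlonglongrightarrow> 1" "\<mu> \<longlonglongrightarrow> L"
    "\<And>j n. a n * of_real (r j) ^ n = fps_nth (U j * V j * V j) n"
    "\<And>j n. (\<Sum>k<n. cmod (fps_nth (U j) k) ^ 2) \<le> \<mu> j"
    "\<And>j n. (\<Sum>k<n. cmod (fps_nth (V j) k) ^ 2) \<le> \<mu> j"
    by (rule factorized_sequence[OF f nz, folded L_def a_def]) (rule that)
  have \<mu>: "0 \<le> \<mu> j" for j using *(4)[where n = 0 and j = j] by simp
  then have L0: "0 \<le> L" using *(2) by (intro LIMSEQ_le_const) auto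
  have Lp: "L powr (3/2) = 1" using norm by (simp add: hardy_norm_def L_def)
  have "L = (L powr (3/2)) powr (2/3)" unfolding powr_powr using L0 by simp
  then have L: "L = 1" unfolding Lp by simp
  have "Bseq \<mu>" using *(2) by (intro convergent_imp_Bseq convergentI)
  then obtain C where C: "\<And>j. \<mu> j \<le> C" by (auto simp: Bseq_def dest: abs_le_D1)
  \<comment> \<open>The coefficients of both factors are placed in one family of eight sequences, so that a single
    subsequence serves all of them.\<close>
  define x where "x = (\<lambda>j k. if k < 4 then fps_nth (U j) k else fps_nth (V j) (k - 4))"
  have one: "cmod (fps_nth W k) \<le> sqrt C" if W: "\<And>n. (\<Sum>k<n. cmod (fps_nth W k) ^ 2) \<le> \<mu> j" for W j k
  proof -
    have "cmod (fps_nth W k) ^ 2 \<le> (\<Sum>k<Suc k. cmod (fps_nth W k) ^ 2)"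
      by (simp add: sum_nonneg)
    also have "\<dots> \<le> C" using W C order_trans by blast
    finally show ?thesis by (simp add: real_le_rsqrt)
  qed
  have "cmod (x j k) \<le> sqrt C" for j k
    using one[OF *(4)] one[OF *(5)] by (simp add: x_def)
  then obtain s :: "nat \<Rightarrow> nat" and l where s: "strict_mono (s :: nat \<Rightarrow> nat)" "\<And>k. k < 8 \<Longrightarrow> (\<lambda>j. x (s j) k) \<longlonglongrightarrow> l k"
    by (rule bounded_family_subsequence[of x "sqrt C" 8]) (rule that)
  define u v where "u = l" and "v = (\<lambda>k. l (k + 4))"
  have u: "(\<lambda>j. fps_nth (U (s j)) k) \<longlonglongrightarrow> u k" and v: "(\<lambda>j. fps_nth (V (s j)) k) \<longlonglongrightarrow> v k" if "k < 4" for k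
    using s(2)[of k] s(2)[of "k + 4"] that by (simp_all add: x_def u_def v_def)
  have \<mu>s: "(\<lambda>j. \<mu> (s j)) \<longlonglongrightarrow> 1"
    using LIMSEQ_subseq_LIMSEQ[OF *(2) s(1)] L by (simp add: o_def)
  have rs: "(\<lambda>j. r (s j)) \<longlonglongrightarrow> 1"
    using LIMSEQ_subseq_LIMSEQ[OF *(1) s(1)] by (simp add: o_def)
  have sum_le: "(\<Sum>k<4. cmod (w k) ^ 2) \<le> 1"
    if "\<And>k. k < 4 \<Longrightarrow> (\<lambda>j. fps_nth (W (s j)) k) \<longlonglongrightarrow> w k"
      "\<And>j n. (\<Sum>k<n. cmod (fps_nth (W j) k) ^ 2) \<le> \<mu> j" for w W
  proof (rule LIMSEQ_le[OF _ \<mu>s])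
    show "(\<lambda>j. \<Sum>k<4. cmod (fps_nth (W (s j)) k) ^ 2) \<longlonglongrightarrow> (\<Sum>k<4. cmod (w k) ^ 2)"
      using that(1) by (intro tendsto_intros) auto
  qed (use that(2) in auto)
  have lim_a: "(\<lambda>j. a n * of_real (r (s j)) ^ n) \<longlonglongrightarrow> a n" for n
    by (rule tendsto_eq_intros rs refl | simp)+
  have "(\<lambda>j. cubic_coeff (fps_nth (U (s j))) (fps_nth (V (s j)))) \<longlonglongrightarrow> cubic_coeff u v"
    unfolding cubic_coeff_def by (intro tendsto_intros u v) auto
  then have "cubic_coeff u v = a 3"
    using lim_a[of 3] unfolding *(3) fps_nth_mult_cubic by (rule LIMSEQ_unique)
  then have eq: "cubic_coeff u v = of_real max_coeff" by (simp add: a3)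
  have sum_u: "(\<Sum>k<4. cmod (u k) ^ 2) \<le> 1" by (rule sum_le[OF u *(4)])
  have sum_v: "(\<Sum>k<4. cmod (v k) ^ 2) \<le> 1" by (rule sum_le[OF v *(5)])
  obtain \<phi> \<theta> where uv: "\<And>k. k < 4 \<Longrightarrow> u k = cis (- 2 * \<phi> - 3 * \<theta>) * cis (k * \<theta>) * extremal_coeff k"
    "\<And>k. k < 4 \<Longrightarrow> v k = cis \<phi> * cis (k * \<theta>) * extremal_coeff k"
    by (rule cubic_coeff_equality[OF sum_u sum_v eq]) (rule that)
  \<comment> \<open>For \<open>k \<ge> 4\<close> the coefficient is squeezed: its squared modulus is at most the mean minus the squared
    moduli of the first four coefficients, which tends to \<open>1 - 1\<close>.\<close>
  have full: "(\<lambda>j. fps_nth (W (s j)) k) \<longlonglongrightarrow> rotated_coeff c \<theta> k"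
    if lim: "\<And>k. k < 4 \<Longrightarrow> (\<lambda>j. fps_nth (W (s j)) k) \<longlonglongrightarrow> w k"
      and le: "\<And>j n. (\<Sum>k<n. cmod (fps_nth (W j) k) ^ 2) \<le> \<mu> j"
      and w: "\<And>k. k < 4 \<Longrightarrow> w k = c * cis (k * \<theta>) * extremal_coeff k" and c: "cmod c = 1" for W w c k
  proof (cases "k < 4")
    case True
    then show ?thesis using lim[OF True] w[OF True] by (simp add: rotated_coeff_def)
  next
    case False
    have "(\<Sum>k<4. cmod (w k) ^ 2) = (\<Sum>k<4. extremal_coeff k ^ 2)"
      by (intro sum.cong) (auto simp: w norm_mult c)
    then have w1: "(\<Sum>k<4. cmod (w k) ^ 2) = 1" by (simp add: extremal_coeff_sum)
    have "(\<lambda>j. cmod (fps_nth (W (s j)) k) ^ 2) \<longlonglongrightarrow> 0"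
    proof (rule tendsto_sandwich[where f = "\<lambda>_. 0"
          and h = "\<lambda>j. \<mu> (s j) - (\<Sum>k<4. cmod (fps_nth (W (s j)) k) ^ 2)"])
      show "(\<lambda>j. \<mu> (s j) - (\<Sum>k<4. cmod (fps_nth (W (s j)) k) ^ 2)) \<longlonglongrightarrow> 0"
      proof -
        have "(\<lambda>j. \<mu> (s j) - (\<Sum>k<4. cmod (fps_nth (W (s j)) k) ^ 2)) \<longlonglongrightarrow> 1 - (\<Sum>k<4. cmod (w k) ^ 2)"
          by (intro tendsto_intros \<mu>s lim) auto
        then show ?thesis by (simp add: w1)
      qed
      show "eventually (\<lambda>j. cmod (fps_nth (W (s j)) k) ^ 2 \<le> \<mu> (s j) - (\<Sum>k<4. cmod (fps_nth (W (s j)) k) ^ 2)) sequentially"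
      proof (intro always_eventually allI)
        fix j
        have "cmod (fps_nth (W (s j)) k) ^ 2 + (\<Sum>k<4. cmod (fps_nth (W (s j)) k) ^ 2)
            = (\<Sum>i\<in>insert k {..<4}. cmod (fps_nth (W (s j)) i) ^ 2)"
          using False by simp
        also have "\<dots> \<le> (\<Sum>i<Suc k. cmod (fps_nth (W (s j)) i) ^ 2)"
          by (rule sum_mono2) (use False in auto)
        also have "\<dots> \<le> \<mu> (s j)" by (rule le)
        finally show "cmod (fps_nth (W (s j)) k) ^ 2 \<le> \<mu> (s j) - (\<Sum>k<4. cmod (fps_nth (W (s j)) k) ^ 2)" by simp
      qed
    qed (auto intro: always_eventually)
    then have "(\<lambda>j. sqrt (cmod (fps_nth (W (s j)) k) ^ 2)) \<longlonglongrightarrow> sqrt 0"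
      by (rule tendsto_real_sqrt)
    then have "(\<lambda>j. fps_nth (W (s j)) k) \<longlonglongrightarrow> 0"
      by (simp add: tendsto_norm_zero_iff)
    then show ?thesis using False by (simp add: rotated_coeff_def)
  qed
  define c d where "c = cis (- 2 * \<phi> - 3 * \<theta>)" and "d = cis \<phi>"
  have U: "(\<lambda>j. fps_nth (U (s j)) k) \<longlonglongrightarrow> rotated_coeff c \<theta> k" for k
    by (rule full[OF u *(4)]) (simp_all add: uv(1) c_def)
  have V: "(\<lambda>j. fps_nth (V (s j)) k) \<longlonglongrightarrow> rotated_coeff d \<theta> k" for k
    by (rule full[OF v *(5)]) (simp_all add: uv(2) d_def)
  have "c * d ^ 2 = cis (- 3 * \<theta>)"
    by (simp add: c_def d_def Complex.DeMoivre cis_mult)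
  note fps = rotated_extremal_fps[OF this]
  have "a n = fps_nth (fps_expansion (rotated_extremal \<theta>) 0) n" for n
  proof (rule LIMSEQ_unique[OF lim_a])
    show "(\<lambda>j. a n * of_real (r (s j)) ^ n) \<longlonglongrightarrow> fps_nth (fps_expansion (rotated_extremal \<theta>) 0) n"
      unfolding *(3) fps fps_mult_nth fps_nth_Abs_fps
      by (intro tendsto_intros U V)
  qed
  then have "fps_expansion f 0 = fps_expansion (rotated_extremal \<theta>) 0"
    by (simp add: fps_eq_iff a_def)
  then show thesis
    using holomorphic_eqI_fps_expansion[OF hol rotated_extremal_holomorphic] by (intro that[of \<theta>]) blast
qed


section \<open>The constant and the extremal functions\<close>

lemma max_coeff_numeric: "1.4973 \<le> max_coeff" "max_coeff < 1.4974"
proof -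
  have "5.742 < sqrt 33"
    by (rule real_less_rsqrt) (simp add: power2_eq_square)
  moreover have "sqrt 33 < 5.746"
    by (rule real_less_lsqrt) (simp_all add: power2_eq_square)
  ultimately have "1.4973 ^ 2 \<le> 2 * (1103 + 33 * sqrt 33) / 1153" "2 * (1103 + 33 * sqrt 33) / 1153 < 1.4974 ^ 2"
    by (simp_all add: power2_eq_square)
  then show "1.4973 \<le> max_coeff" "max_coeff < 1.4974"
    unfolding max_coeff_def by (intro real_le_rsqrt real_less_lsqrt; simp)+
qed

lemma coeff_bound_3_iff: "coeff_bound 3 (2/3) C \<longleftrightarrow> max_coeff \<le> C"
proof
  assume C: "coeff_bound 3 (2/3) C"
  have P: "rotated_extremal 0 \<in> hardy_space (2/3)" "hardy_norm (2/3) (rotated_extremal 0) = 1"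
    "fps_nth (fps_expansion (rotated_extremal 0) 0) 3 = of_real max_coeff"
    using rotated_extremal_properties[of "rotated_extremal 0" 0] by auto
  have "\<forall>z\<in>ball 0 1. (\<lambda>n. fps_nth (fps_expansion (rotated_extremal 0) 0) n * z ^ n) sums rotated_extremal 0 z"
    using holomorphic_power_series[OF rotated_extremal_holomorphic, of _ 0 1 0] by (simp add: fps_expansion_def)
  then have "cmod (fps_nth (fps_expansion (rotated_extremal 0) 0) 3) \<le> C * hardy_norm (2/3) (rotated_extremal 0)"
    using C P(1) unfolding coeff_bound_def by blast
  then show "max_coeff \<le> C" using P(2,3) max_coeff_pos by simp
next
  assume C: "max_coeff \<le> C"
  show "coeff_bound 3 (2/3) C"
    unfolding coeff_bound_def
  proof (intro ballI allI impI)
    fix f and a :: "nat \<Rightarrow> complex"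
    assume f: "f \<in> hardy_space (2/3)" and a: "\<forall>z\<in>ball 0 1. (\<lambda>n. a n * z ^ n) sums f z"
    have "f has_fps_expansion Abs_fps a"
      by (rule sums_imp_has_fps_expansion[of 1]) (use a in auto)
    then have "fps_expansion f 0 = Abs_fps a" by (rule fps_expansion_eqI)
    then have "cmod (a 3) \<le> max_coeff * hardy_norm (2/3) f"
      using third_coefficient_bound[OF f] by simp
    also have "\<dots> \<le> C * hardy_norm (2/3) f"
      using C by (intro mult_right_mono) (simp_all add: hardy_norm_def)
    finally show "cmod (a 3) \<le> C * hardy_norm (2/3) f" .
  qed
qed

lemma coeff_const_3: "coeff_const 3 (2/3) = max_coeff"
  unfolding coeff_const_def by (rule Least_equality) (simp_all add: coeff_bound_3_iff)

theorem theorem2: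
  shows "(coeff_bound 3 (2/3) (coeff_const 3 (2/3))) \<and>
    (\<forall>C. coeff_bound 3 (2/3) C \<longrightarrow> coeff_const 3 (2/3) \<le> C) \<and>
    (coeff_const 3 (2/3) =
           Sup {Re ((deriv ^^ 3) f 0 / fact 3) | f. f \<in> hardy_space (2/3) \<and> hardy_norm (2/3) f = 1}) \<and>
    (coeff_const 3 (2/3) = sqrt (2 * (1103 + 33 * sqrt 33) / 1153)) \<and>
    (1.4973 \<le> coeff_const 3 (2/3) \<and> coeff_const 3 (2/3) < 1.4974) \<and>
    (extremal_fun \<in> hardy_space (2/3) \<and> hardy_norm (2/3) extremal_fun = 1 \<and>
           Re ((deriv ^^ 3) extremal_fun 0 / fact 3) = coeff_const 3 (2/3)) \<and>
    (\<forall>g :: complex \<Rightarrow> complex.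
           (g \<in> hardy_space (2/3) \<and> hardy_norm (2/3) g = 1 \<and>
              Re ((deriv ^^ 3) g 0 / fact 3) = coeff_const 3 (2/3)) \<longleftrightarrow>
           (\<exists>\<theta>::real. \<forall>z\<in>ball 0 1. g z = cis (- 3 * \<theta>) * extremal_fun (cis \<theta> * z)))"
proof -
  have coeff: "(deriv ^^ 3) f 0 / fact 3 = fps_nth (fps_expansion f 0) 3" for f
    by (simp add: fps_expansion_def)
  define X where "X = {Re ((deriv ^^ 3) f 0 / fact 3) | f. f \<in> hardy_space (2/3) \<and> hardy_norm (2/3) f = 1}"
  have E: "extremal_fun \<in> hardy_space (2/3)" "hardy_norm (2/3) extremal_fun = 1"
    "fps_nth (fps_expansion extremal_fun 0) 3 = of_real max_coeff"
    using rotated_extremal_properties[of extremal_fun 0] by (auto simp: rotated_extremal_def)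
  have "Sup X = max_coeff"
  proof (rule cSup_eq_maximum)
    show "max_coeff \<in> X"
      unfolding X_def coeff using E by (intro CollectI exI[of _ extremal_fun]) simp
    show "x \<le> max_coeff" if xX: "x \<in> X" for x
    proof -
      obtain f where f: "f \<in> hardy_space (2/3)" "hardy_norm (2/3) f = 1" "x = Re (fps_nth (fps_expansion f 0) 3)"
        using xX unfolding X_def coeff by blast
      then show ?thesis
        using third_coefficient_bound[OF f(1)] complex_Re_le_cmod[of "fps_nth (fps_expansion f 0) 3"] by simp
    qed
  qed
  moreover have "(g \<in> hardy_space (2/3) \<and> hardy_norm (2/3) g = 1 \<and> Re (fps_nth (fps_expansion g 0) 3) = max_coeff) \<longleftrightarrow>
      (\<exists>\<theta>::real. \<forall>z\<in>ball 0 1. g z = rotated_extremal \<theta> z)" for g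
  proof
    assume g: "g \<in> hardy_space (2/3) \<and> hardy_norm (2/3) g = 1 \<and> Re (fps_nth (fps_expansion g 0) 3) = max_coeff"
    obtain \<theta> where "\<And>z. z \<in> ball 0 1 \<Longrightarrow> g z = rotated_extremal \<theta> z"
      by (rule extremal_unique[of g]) (use g in auto)
    then show "\<exists>\<theta>::real. \<forall>z\<in>ball 0 1. g z = rotated_extremal \<theta> z" by blast
  next
    assume "\<exists>\<theta>::real. \<forall>z\<in>ball 0 1. g z = rotated_extremal \<theta> z"
    then obtain \<theta> where "\<And>z. z \<in> ball 0 1 \<Longrightarrow> g z = rotated_extremal \<theta> z" by blast
    from rotated_extremal_properties[OF this]
    show "g \<in> hardy_space (2/3) \<and> hardy_norm (2/3) g = 1 \<and> Re (fps_nth (fps_expansion g 0) 3) = max_coeff"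
      by simp
  qed
  ultimately show ?thesis
    unfolding coeff_const_3 coeff coeff_bound_3_iff max_coeff_def[symmetric] X_def[symmetric, unfolded coeff] rotated_extremal_def[symmetric]
    using E max_coeff_numeric by (simp add: X_def coeff)
qed

end
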